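(* Let $\zeta_1,\chi,\nu>0$ and let $\eta$ be the stationary solution of $\ddot\eta(t)+2\zeta_1\dot\eta(t)+\chi^2\eta(t)=\nu\dot W(t)$. Take $$A=\begin{pmatrix}0&1\\-\chi^2&-2\zeta_1\end{pmatrix},\quad B=\begin{pmatrix}0\\ \nu\end{pmatrix},\quad a=\begin{pmatrix}-\chi^2\\-2\zeta_1\end{pmatrix},\quad\gamma=\nu ,$$ so that $v=(\eta,\dot\eta)^{T}$ satisfies $dv=Av\,dt+B\,dW$ and $\xi:=\ddot\eta=\langle a,v\rangle+\gamma\dot W$. For $\omega\ne0$ let $$\lambda_2(\omega)=\frac{\pi}{\omega^2}\Bigl(\langle a,\widehat S_A(\omega)Ra\rangle+\langle a,\widehat S_A(\omega)B\gamma\rangle+\frac{\gamma^2}{2\pi}\Bigr).$$ Then $$\lambda_2(\omega)=\pi S_{\dot\eta}(\omega)=\frac{\omega^2\nu^2}{2\bigl[(\chi^2-\omega^2)^2+4\zeta_1^2\omega^2\bigr]}.$$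
   Context: $W$ is a standard one-dimensional Brownian motion. $R=\int_0^\infty e^{tA}BB^*e^{tA^*}\,dt$ is the stationary covariance matrix of $v$, and $\widehat S_A(\omega)=\frac1\pi\int_0^\infty e^{tA}\cos\omega t\,dt$. For an $L^2$ stationary mean-zero scalar process $X$, the power spectral density is $S_X(\omega)=\frac1\pi\int_0^\infty\mathbb{E}[X(t)X(0)]\cos\omega t\,dt$. *)

theory Defs
  imports "HOL-Probability.Probability"
begin

definition standard_brownian_motion :: "'w measure \<Rightarrow> (real \<Rightarrow> 'w \<Rightarrow> real) \<Rightarrow> bool" where
  "standard_brownian_motion M W \<longleftrightarrow>
     prob_space M \<and>
     (\<forall>t\<ge>0. W t \<in> borel_measurable M) \<and>
     (AE x in M. W 0 x = 0) \<and>
     (\<forall>s t. 0 \<le> s \<and> s < t \<longrightarrow>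
        distributed M lborel (\<lambda>x. W t x - W s x) (normal_density 0 (sqrt (t - s)))) \<and>
     (\<forall>(n::nat) (\<tau> :: nat \<Rightarrow> real). 0 \<le> \<tau> 0 \<and> mono \<tau> \<longrightarrow>
        prob_space.indep_vars M (\<lambda>_. borel) (\<lambda>i x. W (\<tau> (Suc i)) x - W (\<tau> i) x) {..<n}) \<and>
     (AE x in M. continuous_on {0..} (\<lambda>t. W t x))"

definition strictly_stationary ::
    "'w measure \<Rightarrow> (real \<Rightarrow> 'w \<Rightarrow> 'b::topological_space) \<Rightarrow> bool" where
  "strictly_stationary M X \<longleftrightarrow>
     (\<forall>I h. finite I \<and> I \<subseteq> {0..} \<and> 0 \<le> h \<longrightarrow>
        distr M (\<Pi>\<^sub>M t\<in>I. borel) (\<lambda>x. \<lambda>t\<in>I. X (t + h) x) =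
        distr M (\<Pi>\<^sub>M t\<in>I. borel) (\<lambda>x. \<lambda>t\<in>I. X t x))"

text \<open>The noise in the equations below is additive, so a stochastic differential equation is
  its pathwise time-integrated form and no stochastic integral is involved.  As usual for
  equations on the half-line, the initial state is independent of the driving Brownian motion.\<close>

definition independent_of_noise ::
    "'w measure \<Rightarrow> (real \<Rightarrow> 'w \<Rightarrow> real) \<Rightarrow> ('w \<Rightarrow> 'b::topological_space) \<Rightarrow> bool" where
  "independent_of_noise M W Z \<longleftrightarrow>
     prob_space.indep_set M
       (sets (vimage_algebra (space M) Z borel))
       (sets (vimage_algebra (space M) (\<lambda>x. \<lambda>t\<in>{0..}. W t x) (\<Pi>\<^sub>M t\<in>{0..}. borel)))"

definition linear_sde_solution ::
    "'w measure \<Rightarrow> (real \<Rightarrow> 'w \<Rightarrow> real) \<Rightarrow> real^'n^'n \<Rightarrow> real^'n \<Rightarrow> (real \<Rightarrow> 'w \<Rightarrow> real^'n) \<Rightarrow> bool"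
  where
  "linear_sde_solution M W A B v \<longleftrightarrow>
     (\<forall>t\<ge>0. v t \<in> borel_measurable M) \<and>
     independent_of_noise M W (v 0) \<and>
     (AE x in M. continuous_on {0..} (\<lambda>t. v t x) \<and>
        (\<forall>t\<ge>0. v t x - v 0 x = integral {0..t} (\<lambda>s. A *v v s x) + (W t x - W 0 x) *\<^sub>R B))"

text \<open>The equation \<open>\<eta>'' + 2 \<zeta> \<eta>' + chi\<^sup>2 \<eta> = \<nu> W'\<close>; the argument \<open>\<eta>'\<close> is the derivative
  process of \<open>\<eta>\<close>.\<close>

definition oscillator_solution ::
    "'w measure \<Rightarrow> (real \<Rightarrow> 'w \<Rightarrow> real) \<Rightarrow> real \<Rightarrow> real \<Rightarrow> real \<Rightarrow>
     (real \<Rightarrow> 'w \<Rightarrow> real) \<Rightarrow> (real \<Rightarrow> 'w \<Rightarrow> real) \<Rightarrow> bool" where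
  "oscillator_solution M W \<zeta> chi \<nu> \<eta> \<eta>' \<longleftrightarrow>
     (\<forall>t\<ge>0. \<eta> t \<in> borel_measurable M \<and> \<eta>' t \<in> borel_measurable M) \<and>
     independent_of_noise M W (\<lambda>x. (\<eta> 0 x, \<eta>' 0 x)) \<and>
     (AE x in M. continuous_on {0..} (\<lambda>t. \<eta>' t x) \<and>
        (\<forall>t\<ge>0. ((\<lambda>s. \<eta> s x) has_real_derivative \<eta>' t x) (at t within {0..})) \<and>
        (\<forall>t\<ge>0. \<eta>' t x - \<eta>' 0 x + integral {0..t} (\<lambda>s. 2 * \<zeta> * \<eta>' s x + chi\<^sup>2 * \<eta> s x)
                 = \<nu> * (W t x - W 0 x)))"

definition power_spectral_density ::
    "'w measure \<Rightarrow> (real \<Rightarrow> 'w \<Rightarrow> real) \<Rightarrow> real \<Rightarrow> real" where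
  "power_spectral_density M X \<omega> =
     1 / pi * (LINT t:{0..}|lborel. (\<integral>x. X t x * X 0 x \<partial>M) * cos (\<omega> * t))"

text \<open>The library's \<open>exp\<close> needs a normed algebra, and the product of the type \<open>real^'n^'n\<close> is
  the componentwise one, so the matrix exponential is defined by its power series.\<close>

definition matrix_exp :: "real^'n^'n \<Rightarrow> real^'n^'n" where
  "matrix_exp A = (\<Sum>k. (1 / fact k) *\<^sub>R (((**) A) ^^ k) (mat 1))"

definition outer_product :: "real^'n \<Rightarrow> real^'n \<Rightarrow> real^'n^'n" where
  "outer_product x y = (\<chi> i j. x $ i * y $ j)"

text \<open>The column matrix \<open>B\<close> is a vector here, so \<open>B B\<^sup>*\<close> is its outer product with itself.\<close>

definition stationary_covariance :: "real^'n^'n \<Rightarrow> real^'n \<Rightarrow> real^'n^'n" where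
  "stationary_covariance A B =
     (LINT t:{0..}|lborel.
        matrix_exp (t *\<^sub>R A) ** outer_product B B ** matrix_exp (t *\<^sub>R transpose A))"

definition S_hat :: "real^'n^'n \<Rightarrow> real \<Rightarrow> real^'n^'n" where
  "S_hat A \<omega> = (1 / pi) *\<^sub>R (LINT t:{0..}|lborel. cos (\<omega> * t) *\<^sub>R matrix_exp (t *\<^sub>R A))"

definition lambda2 :: "real^'n^'n \<Rightarrow> real^'n \<Rightarrow> real^'n \<Rightarrow> real \<Rightarrow> real \<Rightarrow> real" where
  "lambda2 A B a \<gamma> \<omega> = pi / \<omega>\<^sup>2 *
     (a \<bullet> (S_hat A \<omega> *v (stationary_covariance A B *v a))
      + a \<bullet> (S_hat A \<omega> *v (\<gamma> *\<^sub>R B))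
      + \<gamma>\<^sup>2 / (2 * pi))"

end

theory Submission
  imports Defs "HOL-Real_Asymp.Real_Asymp"
begin

text \<open>The entries of the matrix exponential are decaying solutions of
  \<open>p' = q\<close>, \<open>q' = - c\<^sup>2 p - 2 z q\<close>; integration by parts over the half-line turns every
  integral in \<open>\<lambda>\<^sub>2\<close> into linear equations in the initial values.  For the process, let
  \<open>(P, Q)\<close> be the solution of the adjoint equation with terminal value \<open>(u1, u2)\<close> at time \<open>T\<close>.
  Then \<open>P \<eta> + Q \<eta>'\<close> changes only by the noise \<open>\<nu> Q dW\<close>, so pathwise
  \<open>u1 \<eta> T + u2 \<eta>' T\<close> is a linear function of the initial state plus a limit of weighted sums of
  Brownian increments.  With independence this expresses its characteristic function through the
  one of the initial state and a Gaussian factor.  Stationarity and \<open>T \<rightarrow> \<infinity>\<close> force the initial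
  state to be Gaussian, so no moment has to be assumed finite, and polarization of the variances of
  \<open>\<eta>' T \<plusminus> \<eta>' 0\<close> gives the autocovariance of \<open>\<eta>'\<close>.\<close>

section \<open>The matrix exponential\<close>

lemma funpow_matrix_mult_vec:
  fixes A :: "real^'n^'n"
  shows "((((**) A) ^^ k) (mat 1)) *v x = (((*v) A) ^^ k) x"
  by (induction k) (simp_all add: matrix_vector_mul_assoc[symmetric])

lemma norm_funpow_matrix_vector_mult_le:
  fixes A :: "real^'n^'n"
  shows "norm ((((*v) A) ^^ k) x) \<le> onorm ((*v) A) ^ k * norm x"
proof (induction k)
  case (Suc k)
  have "norm ((((*v) A) ^^ Suc k) x) \<le> onorm ((*v) A) * norm ((((*v) A) ^^ k) x)"
    by (simp add: onorm matrix_vector_mul_bounded_linear)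
  also have "\<dots> \<le> onorm ((*v) A) * (onorm ((*v) A) ^ k * norm x)"
    by (intro mult_left_mono Suc onorm_pos_le matrix_vector_mul_bounded_linear)
  finally show ?case by (simp add: mult_ac)
qed simp

lemma funpow_matrix_vector_mult_scaleR:
  fixes A :: "real^'n^'n"
  shows "(((*v) (t *\<^sub>R A)) ^^ k) x = t ^ k *\<^sub>R (((*v) A) ^^ k) x"
  by (induction k)
    (simp_all add: scaleR_matrix_vector_assoc[symmetric] matrix_vector_mult_scaleR mult_ac)

lemma summable_matrix_exp_vec:
  fixes A :: "real^'n^'n"
  shows "summable (\<lambda>k. (1 / fact k) *\<^sub>R (((*v) A) ^^ k) x)"
proof (rule summable_comparison_test')
  show "summable (\<lambda>k. inverse (fact k) * onorm ((*v) A) ^ k * norm x)"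
    by (intro summable_mult2 summable_exp)
  show "norm ((1 / fact k) *\<^sub>R (((*v) A) ^^ k) x) \<le> inverse (fact k) * onorm ((*v) A) ^ k * norm x" for k
    using norm_funpow_matrix_vector_mult_le[of k A x]
    by (simp add: field_simps)
qed

lemma vec_sumsI:
  fixes f :: "nat \<Rightarrow> 'a::real_normed_vector^'n"
  assumes "\<And>i. (\<lambda>k. f k $ i) sums (l $ i)"
  shows "f sums l"
  using assms unfolding sums_def by (intro vec_tendstoI) simp

lemma vec_sumsD: 
  fixes f :: "nat \<Rightarrow> 'a::real_normed_vector^'n"
  assumes "f sums l"
  shows "(\<lambda>k. f k $ i) sums (l $ i)"
  using assms by (rule bounded_linear.sums[OF bounded_linear_vec_nth])

text \<open>Column j of the k-th power is that power applied to \<open>axis j 1\<close>, so every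
  entry is a coordinate of a vector series already known to converge.\<close>

lemma summable_matrix_exp:
  fixes A :: "real^'n^'n"
  shows "summable (\<lambda>k. (1 / fact k) *\<^sub>R (((**) A) ^^ k) (mat 1))"
proof -
  let ?f = "\<lambda>k. (1 / fact k) *\<^sub>R (((**) A) ^^ k) (mat 1)"
  have "summable (\<lambda>k. ?f k $ i $ j)" for i j
  proof -
    have "?f k $ i $ j = ((1 / fact k) *\<^sub>R (((*v) A) ^^ k) (axis j 1)) $ i" for k
      unfolding funpow_matrix_mult_vec[symmetric] by (simp add: matrix_vector_mult_basis column_def)
    then show ?thesis
      using vec_sumsD[OF summable_sums[OF summable_matrix_exp_vec[of A "axis j 1"]], of i]
      by (simp only: sums_summable)
  qed
  then have "?f sums (\<chi> i j. \<Sum>k. ?f k $ i $ j)"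
    by (intro vec_sumsI) (simp only: vec_lambda_beta summable_sums)
  then show ?thesis by (rule sums_summable)
qed

lemma bounded_linear_matrix_vector_mult_left:
  "bounded_linear (\<lambda>A :: real^'n^'m. A *v x)"
  by (rule linear_conv_bounded_linear[THEN iffD1], rule linearI)
    (simp_all add: matrix_vector_mult_add_rdistrib scaleR_matrix_vector_assoc)

lemma bounded_linear_transpose: "bounded_linear (transpose :: real^'n^'m \<Rightarrow> real^'m^'n)"
  by (rule linear_conv_bounded_linear[THEN iffD1], rule linearI)
    (simp_all add: transpose_def vec_eq_iff)

text \<open>Application to a fixed vector is bounded linear in the matrix and hence passes inside
  the series. This reduces the calculus of the exponential to vector orbits and their scalar
  coordinates.\<close>

lemma matrix_exp_vec:
  fixes A :: "real^'n^'n"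
  shows "matrix_exp A *v x = (\<Sum>k. (1 / fact k) *\<^sub>R (((*v) A) ^^ k) x)"
  using bounded_linear.suminf[OF bounded_linear_matrix_vector_mult_left summable_matrix_exp, of A x]
  by (simp add: matrix_exp_def scaleR_matrix_vector_assoc[symmetric] funpow_matrix_mult_vec)

lemma matrix_exp_0_vec: "matrix_exp (0::real^'n^'n) *v x = x"
proof -
  have "(1 / fact k) *\<^sub>R (((*v) (0::real^'n^'n)) ^^ k) x = (if k = 0 then x else 0)" for k
    by (cases k) simp_all
  moreover have "(\<Sum>k. if k = 0 then x else 0) = x"
    using sums_unique[OF sums_single[of 0 "\<lambda>_. x"]] by simp
  ultimately show ?thesis
    unfolding matrix_exp_vec by presburger
qed

text \<open>Each coordinate is a scalar power series in \<open>t\<close> that converges everywhere,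
  so it may be differentiated termwise.\<close>

lemma matrix_exp_vec_has_derivative:
  fixes A :: "real^'n^'n"
  shows "((\<lambda>t. (matrix_exp (t *\<^sub>R A) *v x) $ i) has_real_derivative
           (A *v (matrix_exp (t *\<^sub>R A) *v x)) $ i) (at t)"
proof -
  define P where "P k = (((*v) A) ^^ k) x" for k
  define c where "c k = P k $ i / fact k" for k
  have *: "(\<lambda>k. P k $ j / fact k * t ^ k) sums (matrix_exp (t *\<^sub>R A) *v x) $ j" for t j
    using vec_sumsD[OF summable_sums[OF summable_matrix_exp_vec[of "t *\<^sub>R A" x]], of j]
    by (simp add: matrix_exp_vec funpow_matrix_vector_mult_scaleR P_def mult_ac)
  have "((\<lambda>t. \<Sum>k. c k * t ^ k) has_real_derivative (\<Sum>k. diffs c k * t ^ k)) (at t)"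
    using sums_summable[OF *] unfolding c_def
    by (intro termdiffs_strong_converges_everywhere)
  moreover have "(\<Sum>k. c k * s ^ k) = (matrix_exp (s *\<^sub>R A) *v x) $ i" for s
    using sums_unique[OF *] by (simp add: c_def)
  moreover have "(\<lambda>k. diffs c k * t ^ k) sums (A *v (matrix_exp (t *\<^sub>R A) *v x)) $ i"
  proof -
    have "diffs c k * t ^ k = (\<Sum>j\<in>UNIV. A $ i $ j * (P k $ j / fact k * t ^ k))" for k
    proof -
      \<comment> \<open>The factor \<open>Suc k\<close> introduced by \<open>diffs\<close> cancels
        against \<open>fact (Suc k)\<close>, and the shifted index leaves one more application of
        \<open>A\<close>.\<close>
      have "diffs c k = (A *v P k) $ i / fact k"
        by (simp add: diffs_def c_def P_def del: of_nat_Suc)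
      then show ?thesis
        by (simp add: matrix_vector_mult_def sum_divide_distrib sum_distrib_right sum_distrib_left mult_ac)
    qed
    moreover have "(\<lambda>k. \<Sum>j\<in>UNIV. A $ i $ j * (P k $ j / fact k * t ^ k)) sums
        (\<Sum>j\<in>UNIV. A $ i $ j * (matrix_exp (t *\<^sub>R A) *v x) $ j)"
      by (intro sums_sum sums_mult *)
    ultimately show ?thesis
      by (simp add: matrix_vector_mul_component inner_vec_def)
  qed
  ultimately show ?thesis
    by (simp add: sums_iff)
qed

text \<open>Transposition reverses products, so \<open>A\<close> is first commuted past its own
  powers. The result identifies the right factor in \<open>stationary_covariance\<close> as the
  transpose of the left one.\<close>

lemma transpose_matrix_exp:
  fixes A :: "real^'n^'n"
  shows "transpose (matrix_exp A) = matrix_exp (transpose A)"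
proof -
  have comm: "A ** (((**) A) ^^ k) (mat 1) = (((**) A) ^^ k) (mat 1) ** A" for A :: "real^'n^'n" and k
  proof (induction k)
    case (Suc k)
    have "A ** (((**) A) ^^ Suc k) (mat 1) = A ** ((((**) A) ^^ k) (mat 1) ** A)"
      by (simp add: Suc)
    then show ?case by (simp add: matrix_mul_assoc)
  qed simp
  have "transpose ((((**) A) ^^ k) (mat 1)) = (((**) (transpose A)) ^^ k) (mat 1)" for k
  proof (induction k)
    case (Suc k)
    have "transpose (A ** (((**) A) ^^ k) (mat 1)) = transpose A ** transpose ((((**) A) ^^ k) (mat 1))"
      by (simp only: comm matrix_transpose_mul)
    with Suc show ?case by simp
  qed (simp add: transpose_mat)
  moreover have "transpose (c *\<^sub>R B) = c *\<^sub>R transpose B" for c and B :: "real^'n^'n"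
    by (simp add: transpose_def vec_eq_iff)
  ultimately show ?thesis
    unfolding matrix_exp_def
    by (simp add: bounded_linear.suminf[OF bounded_linear_transpose summable_matrix_exp])
qed

section \<open>The damped oscillator equation\<close>

lemma set_integrable_exp_Ici:
  fixes k :: real
  assumes "k > 0"
  shows "set_integrable lborel {0..} (\<lambda>t. exp (- k * t))"
proof -
  have "has_bochner_integral lborel (\<lambda>x. x ^ 0 * exp (- x) * indicator {0 ..} x :: real) (fact 0)"
    by (rule has_bochner_integral_I0i_power_exp_m')
  then have "integrable lborel (\<lambda>x. exp (- x) * indicator {0 ..} x :: real)"
    by (simp add: has_bochner_integral_iff)
  then have "integrable lborel (\<lambda>t. exp (- (0 + k * t)) * indicator {0 ..} (0 + k * t) :: real)"
    using assms by (intro lborel_integrable_real_affine) auto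
  moreover have "indicator {0 ..} (k * t) = (indicator {0 ..} t :: real)" for t
    using assms by (auto simp: indicator_def zero_le_mult_iff)
  ultimately show ?thesis
    by (simp add: set_integrable_def mult.commute)
qed

lemma set_integrable_exp_bounded:
  fixes f :: "real \<Rightarrow> real"
  assumes "k > 0" "continuous_on UNIV f" "\<And>t. t \<ge> 0 \<Longrightarrow> \<bar>f t\<bar> \<le> C * exp (- k * t)"
  shows "set_integrable lborel {0..} f"
proof (rule set_integrable_bound)
  show "set_integrable lborel {0..} (\<lambda>t. C * exp (- k * t))"
    by (intro set_integrable_mult_right set_integrable_exp_Ici assms)
  show "set_borel_measurable lborel {0..} f"
    unfolding set_borel_measurable_def
    using borel_measurable_continuous_onI[OF assms(2)] by measurable
qed (use assms(3) in \<open>auto intro!: AE_I2 order_trans[OF assms(3)]\<close>)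

text \<open>Both sides are limits of the integral over \<open>{0..b}\<close> as b grows. Applied to
  products of decaying functions, this is the integration by parts used throughout.\<close>

lemma set_integral_FTC_Ici:
  fixes F f :: "real \<Rightarrow> real"
  assumes F: "\<And>t. (F has_real_derivative f t) (at t)"
    and cont: "continuous_on UNIV f"
    and int: "set_integrable lborel {0..} f"
    and lim: "(F \<longlongrightarrow> l) at_top"
  shows "(LINT t:{0..}|lborel. f t) = l - F 0"
proof (rule tendsto_unique)
  show "((\<lambda>b. LINT t:{0..b}|lborel. f t) \<longlongrightarrow> (LINT t:{0..}|lborel. f t)) at_top"
    using int by (intro tendsto_set_lebesgue_integral_at_top) auto
  have "\<forall>\<^sub>F b in at_top. F b - F 0 = (LINT t:{0..b}|lborel. f t)"
    using eventually_ge_at_top[of "0::real"]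
  proof eventually_elim
    case (elim b)
    have "(\<integral>t. f t * indicator {0..b} t \<partial>lborel) = F b - F 0"
      using elim F cont
      by (intro integral_FTC_Icc_real) (auto simp: continuous_on_eq_continuous_at)
    then show ?case by (simp add: set_lebesgue_integral_def mult.commute)
  qed
  then show "((\<lambda>b. LINT t:{0..b}|lborel. f t) \<longlongrightarrow> l - F 0) at_top"
    by (rule Lim_transform_eventually[rotated]) (intro tendsto_intros lim)
qed simp

text \<open>The noise-free equation p'' + 2 z p' + c^2 p = 0 as a first-order system. It is required
  at all real times, so that derivatives at 0 are two-sided.\<close>

definition oscillator_orbit :: "real \<Rightarrow> real \<Rightarrow> (real \<Rightarrow> real) \<Rightarrow> (real \<Rightarrow> real) \<Rightarrow> bool" where
  "oscillator_orbit z c p q \<longleftrightarrow>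
     (\<forall>t. (p has_real_derivative q t) (at t) \<and>
          (q has_real_derivative - c\<^sup>2 * p t - 2 * z * q t) (at t))"

text \<open>The coefficients are constant, so the derivative of a solution is again a solution.
  Integration by parts can thus be repeated one derivative higher.\<close>

lemma oscillator_orbit_derivative:
  assumes "oscillator_orbit z c p q"
  shows "oscillator_orbit z c q (\<lambda>t. - c\<^sup>2 * p t - 2 * z * q t)"
  using assms unfolding oscillator_orbit_def
  by (auto intro!: derivative_eq_intros simp: algebra_simps)

lemma oscillator_orbit_continuous:
  assumes "oscillator_orbit z c p q"
  shows "continuous_on S p" "continuous_on S q"
  using assms unfolding oscillator_orbit_def
  by (auto intro!: continuous_at_imp_continuous_on DERIV_isCont)

text \<open>The function \<open>V\<close> solves the Lyapunov equation
  \<open>V' = - 4 z (c\<^sup>2 p\<^sup>2 + q\<^sup>2)\<close>; the derivative of the mechanical energy alone is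
  only semidefinite.\<close>

lemma oscillator_orbit_lyapunov:
  assumes "z > 0" "c > 0"
  shows "\<exists>k>0. \<forall>p q t. oscillator_orbit z c p q \<longrightarrow> t \<ge> 0 \<longrightarrow>
      q t ^ 2 + 2 * c\<^sup>2 * p t ^ 2 \<le> ((q 0 + 2 * z * p 0)\<^sup>2 + q 0 ^ 2 + 2 * c\<^sup>2 * p 0 ^ 2) * exp (- k * t)"
proof -
  \<comment> \<open>\<open>K\<close> is large enough that V is at most K (c^2 p^2 + q^2), as the
    completed square below shows. Hence V' is at most - k V for k = 4 z / K, and V exp (k t) does
    not increase.\<close>
  define K where "K = 5 + 8 * z\<^sup>2 / c\<^sup>2"
  have "K > 0" unfolding K_def using assms by (intro add_pos_nonneg) auto
  define k where "k = 4 * z / K"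
  have k: "k > 0" using assms \<open>K > 0\<close> by (simp add: k_def)
  show ?thesis
  proof (intro exI conjI allI impI)
    show "k > 0" by fact
    fix p q :: "real \<Rightarrow> real" and t :: real
    assume orb: "oscillator_orbit z c p q" and t: "t \<ge> 0"
    define V where "V t = (q t + 2 * z * p t)\<^sup>2 + q t ^ 2 + 2 * c\<^sup>2 * p t ^ 2" for t
    have dV: "(V has_real_derivative - 4 * z * (c\<^sup>2 * p t ^ 2 + q t ^ 2)) (at t)" for t
      using orb unfolding oscillator_orbit_def V_def
      by (auto intro!: derivative_eq_intros simp: algebra_simps power2_eq_square)
    have V_le: "V t \<le> K * (c\<^sup>2 * p t ^ 2 + q t ^ 2)" for t
    proof -
      have "K * (c\<^sup>2 * p t ^ 2 + q t ^ 2) - V t =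
          (q t - 2 * z * p t)\<^sup>2 + 3 * c\<^sup>2 * p t ^ 2 + (2 + 8 * z\<^sup>2 / c\<^sup>2) * q t ^ 2"
        using assms by (simp add: K_def V_def field_simps power2_eq_square)
      also have "\<dots> \<ge> 0"
        by (intro add_nonneg_nonneg mult_nonneg_nonneg) auto
      finally show ?thesis by simp
    qed
    have "V t * exp (k * t) \<le> V 0 * exp (k * 0)"
    proof (rule DERIV_nonpos_imp_nonincreasing[OF t])
      fix s
      have "- 4 * z * (c\<^sup>2 * p s ^ 2 + q s ^ 2) + k * V s \<le> 0"
        using mult_left_mono[OF V_le[of s], of k] k \<open>K > 0\<close> by (simp add: k_def field_simps)
      then have "(- 4 * z * (c\<^sup>2 * p s ^ 2 + q s ^ 2) + k * V s) * exp (k * s) \<le> 0"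
        by (intro mult_nonpos_nonneg) auto
      then show "\<exists>y. ((\<lambda>t. V t * exp (k * t)) has_real_derivative y) (at s) \<and> y \<le> 0"
        by (intro exI[of _ "(- 4 * z * (c\<^sup>2 * p s ^ 2 + q s ^ 2) + k * V s) * exp (k * s)"] conjI)
          (auto intro!: derivative_eq_intros dV simp: algebra_simps)
    qed
    then have "V t \<le> V 0 * exp (- k * t)"
      by (simp add: exp_minus field_simps)
    moreover have "q t ^ 2 + 2 * c\<^sup>2 * p t ^ 2 \<le> V t" by (simp add: V_def)
    ultimately show "q t ^ 2 + 2 * c\<^sup>2 * p t ^ 2 \<le>
        ((q 0 + 2 * z * p 0)\<^sup>2 + q 0 ^ 2 + 2 * c\<^sup>2 * p 0 ^ 2) * exp (- k * t)"
      unfolding V_def[of 0, symmetric] by linarith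
  qed
qed

lemma oscillator_orbit_decay:
  assumes "z > 0" "c > 0" "oscillator_orbit z c p q"
  shows "\<exists>C k. k > 0 \<and> C \<ge> 0 \<and>
    (\<forall>t\<ge>0. \<bar>p t\<bar> \<le> C * exp (- k * t) \<and> \<bar>q t\<bar> \<le> C * exp (- k * t))"
proof -
  obtain k where "k > 0" and k': "\<And>p q t. oscillator_orbit z c p q \<Longrightarrow> t \<ge> 0 \<Longrightarrow>
      q t ^ 2 + 2 * c\<^sup>2 * p t ^ 2 \<le> ((q 0 + 2 * z * p 0)\<^sup>2 + q 0 ^ 2 + 2 * c\<^sup>2 * p 0 ^ 2) * exp (- k * t)"
    using oscillator_orbit_lyapunov[OF assms(1,2)] by auto
  note k = \<open>k > 0\<close> k'[OF assms(3)]
  define V where "V = (q 0 + 2 * z * p 0)\<^sup>2 + q 0 ^ 2 + 2 * c\<^sup>2 * p 0 ^ 2"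
  have V: "V \<ge> 0" by (simp add: V_def)
  \<comment> \<open>The energy bound is quadratic; taking square roots halves the rate.\<close>
  have e: "exp (- k * t) = (exp (- (k/2) * t))\<^sup>2" for t
    by (simp add: exp_double[symmetric])
  \<comment> \<open>One constant that dominates both the bound \<open>sqrt V\<close> for
    \<open>q\<close> and the bound \<open>sqrt V / c\<close> for \<open>p\<close>.\<close>
  define C where "C = sqrt V * (1 + 1 / c)"
  have C: "C \<ge> 0" "sqrt V \<le> C" "sqrt V / c \<le> C" using V assms by (auto simp: C_def field_simps)
  show ?thesis
  proof (intro exI conjI allI impI)
    fix t :: real assume t: "t \<ge> 0"
    have *: "q t ^ 2 + 2 * c\<^sup>2 * p t ^ 2 \<le> (sqrt V * exp (- (k/2) * t))\<^sup>2"
      using k(2)[OF t] V unfolding e V_def[symmetric] by (simp add: power_mult_distrib)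
    have "q t ^ 2 \<le> q t ^ 2 + 2 * c\<^sup>2 * p t ^ 2" by simp
    also note *
    finally have "q t ^ 2 \<le> (sqrt V * exp (- (k/2) * t))\<^sup>2" .
    then have "\<bar>q t\<bar> \<le> sqrt V * exp (- (k/2) * t)"
      using V by (simp add: abs_le_square_iff[symmetric])
    also have "\<dots> \<le> C * exp (- (k/2) * t)" using C by simp
    finally show "\<bar>q t\<bar> \<le> C * exp (- (k/2) * t)" .
    have "(c * p t)\<^sup>2 \<le> q t ^ 2 + 2 * c\<^sup>2 * p t ^ 2"
      by (simp add: power_mult_distrib)
    also note *
    finally have "(c * p t)\<^sup>2 \<le> (sqrt V * exp (- (k/2) * t))\<^sup>2" .
    then have "\<bar>c * p t\<bar> \<le> sqrt V * exp (- (k/2) * t)"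
      using V by (simp add: abs_le_square_iff[symmetric])
    then have "\<bar>p t\<bar> \<le> sqrt V / c * exp (- (k/2) * t)"
      using assms by (simp add: abs_mult field_simps)
    also have "\<dots> \<le> C * exp (- (k/2) * t)" using C by (intro mult_right_mono) auto
    finally show "\<bar>p t\<bar> \<le> C * exp (- (k/2) * t)" .
  qed (use k C in auto)
qed

lemma oscillator_orbit_tendsto:
  assumes "z > 0" "c > 0" "oscillator_orbit z c p q"
  shows "(p \<longlongrightarrow> 0) at_top" "(q \<longlongrightarrow> 0) at_top"
proof -
  obtain C k where "k > 0 \<and> C \<ge> 0 \<and>
    (\<forall>t\<ge>0. \<bar>p t\<bar> \<le> C * exp (- k * t) \<and> \<bar>q t\<bar> \<le> C * exp (- k * t))"
    using oscillator_orbit_decay[OF assms] by blast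
  then have k: "k > 0" "C \<ge> 0"
    "\<And>t. t \<ge> 0 \<Longrightarrow> \<bar>p t\<bar> \<le> C * exp (- k * t)" "\<And>t. t \<ge> 0 \<Longrightarrow> \<bar>q t\<bar> \<le> C * exp (- k * t)"
    by auto
  have "((\<lambda>t. C * exp (- k * t)) \<longlongrightarrow> 0) at_top"
    using k(1) by real_asymp
  note * = Lim_null_comparison[OF _ this]
  have "\<forall>\<^sub>F t in at_top. norm (p t) \<le> C * exp (- k * t)" "\<forall>\<^sub>F t in at_top. norm (q t) \<le> C * exp (- k * t)"
    unfolding real_norm_def
    by (rule eventually_mono[OF eventually_ge_at_top[of "0::real"]], erule k)+
  then show "(p \<longlongrightarrow> 0) at_top" "(q \<longlongrightarrow> 0) at_top"
    by (auto intro: *)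
qed

text \<open>The weight \<open>b\<close> will be a cosine, a sine or a component of the orbit itself,
  which covers both the Fourier and the quadratic integrals.\<close>

lemma oscillator_orbit_integrable:
  assumes "z > 0" "c > 0" "oscillator_orbit z c p q"
    and b: "continuous_on UNIV b" "\<And>t. t \<ge> 0 \<Longrightarrow> \<bar>b t\<bar> \<le> D"
  shows "set_integrable lborel {0..} (\<lambda>t. b t * p t)" "set_integrable lborel {0..} (\<lambda>t. b t * q t)"
proof -
  obtain C k where "k > 0 \<and> C \<ge> 0 \<and>
    (\<forall>t\<ge>0. \<bar>p t\<bar> \<le> C * exp (- k * t) \<and> \<bar>q t\<bar> \<le> C * exp (- k * t))"
    using oscillator_orbit_decay[OF assms(1-3)] by blast
  then have k: "k > 0" "C \<ge> 0"
    "\<And>t. t \<ge> 0 \<Longrightarrow> \<bar>p t\<bar> \<le> C * exp (- k * t)" "\<And>t. t \<ge> 0 \<Longrightarrow> \<bar>q t\<bar> \<le> C * exp (- k * t)"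
    by auto
  have D: "D \<ge> 0" using b(2)[of 0] by auto
  have bound: "\<bar>b t * f t\<bar> \<le> D * C * exp (- k * t)" if "t \<ge> 0" "\<bar>f t\<bar> \<le> C * exp (- k * t)" for f t
    using mult_mono[OF b(2) that(2)] that(1) D by (simp add: abs_mult mult_ac)
  show "set_integrable lborel {0..} (\<lambda>t. b t * p t)" "set_integrable lborel {0..} (\<lambda>t. b t * q t)"
    using k bound by (auto intro!: set_integrable_exp_bounded[of k _ "D * C"] continuous_intros b oscillator_orbit_continuous[OF assms(3)])
qed

lemma oscillator_orbit_bounded:
  assumes "z > 0" "c > 0" "oscillator_orbit z c p q"
  shows "\<exists>D. \<forall>t\<ge>0. \<bar>p t\<bar> \<le> D \<and> \<bar>q t\<bar> \<le> D"
proof -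
  obtain C k where "k > 0 \<and> C \<ge> 0 \<and>
    (\<forall>t\<ge>0. \<bar>p t\<bar> \<le> C * exp (- k * t) \<and> \<bar>q t\<bar> \<le> C * exp (- k * t))"
    using oscillator_orbit_decay[OF assms(1-3)] by blast
  then have k: "k > 0" "C \<ge> 0"
    "\<And>t. t \<ge> 0 \<Longrightarrow> \<bar>p t\<bar> \<le> C * exp (- k * t)" "\<And>t. t \<ge> 0 \<Longrightarrow> \<bar>q t\<bar> \<le> C * exp (- k * t)"
    by auto
  have "C * exp (- k * t) \<le> C" if "t \<ge> 0" for t
    using k that by (simp add: mult_left_le)
  then show ?thesis using k by (meson order_trans)
qed

text \<open>Three primitives suffice: p q is the derivative of p^2 / 2, the energy c^2 p^2 + q^2 has
  derivative - 4 z q^2, and the derivative of p q brings in p^2. All primitives vanish at infinity,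
  so only initial values remain.\<close>

lemma oscillator_orbit_quadratic_integrals:
  assumes zc: "z > 0" "c > 0" and orb: "oscillator_orbit z c p q"
  shows "(LINT t:{0..}|lborel. p t * q t) = - (p 0)\<^sup>2 / 2"
    and "(LINT t:{0..}|lborel. q t * q t) = (c\<^sup>2 * (p 0)\<^sup>2 + (q 0)\<^sup>2) / (4 * z)"
    and "c\<^sup>2 * (LINT t:{0..}|lborel. p t * p t) =
      (c\<^sup>2 * (p 0)\<^sup>2 + (q 0)\<^sup>2) / (4 * z) + z * (p 0)\<^sup>2 + p 0 * q 0"
    and "set_integrable lborel {0..} (\<lambda>t. p t * p t)" 
    and "set_integrable lborel {0..} (\<lambda>t. p t * q t)" 
    and "set_integrable lborel {0..} (\<lambda>t. q t * q t)"
proof -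
  note c = oscillator_orbit_continuous[OF orb] and l = oscillator_orbit_tendsto[OF zc orb]
  have d: "(p has_real_derivative q t) (at t)" "(q has_real_derivative - c\<^sup>2 * p t - 2 * z * q t) (at t)" for t
    using orb by (auto simp: oscillator_orbit_def)
  obtain D where D: "\<And>t. t \<ge> 0 \<Longrightarrow> \<bar>p t\<bar> \<le> D" "\<And>t. t \<ge> 0 \<Longrightarrow> \<bar>q t\<bar> \<le> D"
    using oscillator_orbit_bounded[OF assms] by auto
  show i: "set_integrable lborel {0..} (\<lambda>t. p t * p t)" 
     "set_integrable lborel {0..} (\<lambda>t. p t * q t)" 
     "set_integrable lborel {0..} (\<lambda>t. q t * q t)"
    using D by (auto intro!: oscillator_orbit_integrable[OF assms] c)
  have "(LINT t:{0..}|lborel. p t * q t) = 0 - (p 0)\<^sup>2 / 2"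
    by (rule set_integral_FTC_Ici[where F = "\<lambda>t. (p t)\<^sup>2 / 2"])
      (auto intro!: derivative_eq_intros d continuous_intros c i tendsto_eq_intros l)
  then show pq: "(LINT t:{0..}|lborel. p t * q t) = - (p 0)\<^sup>2 / 2" by simp
  have "(LINT t:{0..}|lborel. q t * q t) = 0 - - ((c\<^sup>2 * (p 0)\<^sup>2 + (q 0)\<^sup>2) / (4 * z))"
    using zc by (intro set_integral_FTC_Ici[where F = "\<lambda>t. - ((c\<^sup>2 * (p t)\<^sup>2 + (q t)\<^sup>2) / (4 * z))"])
      (auto intro!: derivative_eq_intros d continuous_intros c i tendsto_eq_intros l simp: field_simps)
  then show qq: "(LINT t:{0..}|lborel. q t * q t) = (c\<^sup>2 * (p 0)\<^sup>2 + (q 0)\<^sup>2) / (4 * z)" by simp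
  have "(LINT t:{0..}|lborel. q t * q t - c\<^sup>2 * (p t * p t) - 2 * z * (p t * q t)) = 0 - p 0 * q 0"
  proof (rule set_integral_FTC_Ici[where F = "\<lambda>t. p t * q t"])
    show "((\<lambda>t. p t * q t) has_real_derivative q t * q t - c\<^sup>2 * (p t * p t) - 2 * z * (p t * q t)) (at t)" for t
      by (auto intro!: derivative_eq_intros d simp: algebra_simps)
    show "((\<lambda>t. p t * q t) \<longlongrightarrow> 0) at_top"
      by (auto intro!: tendsto_eq_intros l)
  qed (intro continuous_intros c set_integral_diff set_integrable_mult_right i)+
  moreover have "(LINT t:{0..}|lborel. q t * q t - c\<^sup>2 * (p t * p t) - 2 * z * (p t * q t)) =
    (LINT t:{0..}|lborel. q t * q t) - c\<^sup>2 * (LINT t:{0..}|lborel. p t * p t) - 2 * z * (LINT t:{0..}|lborel. p t * q t)"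
    by (simp add: set_integral_diff i set_integrable_mult_right)
  ultimately show "c\<^sup>2 * (LINT t:{0..}|lborel. p t * p t) =
      (c\<^sup>2 * (p 0)\<^sup>2 + (q 0)\<^sup>2) / (4 * z) + z * (p 0)\<^sup>2 + p 0 * q 0"
    using pq qq by simp
qed

text \<open>Integration by parts against cosine and sine, for the orbit and for its derivative,
  gives four linear relations among the four transforms. Eliminating those of \<open>p\<close>
  leaves a two-by-two system for \<open>Cq\<close> and \<open>Sq\<close> whose determinant is
  \<open>D\<close> up to sign.\<close>

lemma oscillator_orbit_cosine_integrals:
  fixes w :: real
  assumes zc: "z > 0" "c > 0" and orb: "oscillator_orbit z c p q" and w: "w \<noteq> 0"
  shows "(LINT t:{0..}|lborel. cos (w * t) * q t) =
      (2 * z * w\<^sup>2 * q 0 + (w\<^sup>2 - c\<^sup>2) * c\<^sup>2 * p 0) / ((c\<^sup>2 - w\<^sup>2)\<^sup>2 + 4 * z\<^sup>2 * w\<^sup>2)"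
    and "(LINT t:{0..}|lborel. cos (w * t) * (- c\<^sup>2 * p t - 2 * z * q t)) = 
      - q 0 + (w\<^sup>2 * (w\<^sup>2 - c\<^sup>2) * q 0 - 2 * z * w\<^sup>2 * c\<^sup>2 * p 0) / ((c\<^sup>2 - w\<^sup>2)\<^sup>2 + 4 * z\<^sup>2 * w\<^sup>2)"
proof -
  define D where "D = (c\<^sup>2 - w\<^sup>2)\<^sup>2 + 4 * z\<^sup>2 * w\<^sup>2"
  have "D > 0" unfolding D_def using zc w by (intro add_nonneg_pos) auto
  have i: "set_integrable lborel {0..} (\<lambda>t. cos (w * t) * p t)" 
     "set_integrable lborel {0..} (\<lambda>t. cos (w * t) * q t)" 
     "set_integrable lborel {0..} (\<lambda>t. sin (w * t) * p t)" 
     "set_integrable lborel {0..} (\<lambda>t. sin (w * t) * q t)" 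
    by (rule oscillator_orbit_integrable[OF zc orb, where D = 1]; auto intro!: continuous_intros)+
  define Cp Cq Sp Sq where defs: "Cp = (LINT t:{0..}|lborel. cos (w * t) * p t)"
    "Cq = (LINT t:{0..}|lborel. cos (w * t) * q t)"
    "Sp = (LINT t:{0..}|lborel. sin (w * t) * p t)"
    "Sq = (LINT t:{0..}|lborel. sin (w * t) * q t)"
  \<comment> \<open>Stated for an arbitrary orbit because it is applied to \<open>p\<close> with
    derivative \<open>q\<close> and again to \<open>q\<close> with its own derivative. Only the
    cosine leaves a boundary term at 0.\<close>
  have parts: "(LINT t:{0..}|lborel. cos (w * t) * f' t) = - f 0 + w * (LINT t:{0..}|lborel. sin (w * t) * f t)"
    "(LINT t:{0..}|lborel. sin (w * t) * f' t) = - w * (LINT t:{0..}|lborel. cos (w * t) * f t)"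
    if orb': "oscillator_orbit z c f f'" for f f'
  proof -
    note c' = oscillator_orbit_continuous[OF orb'] and l = oscillator_orbit_tendsto[OF zc orb']
    have d: "(f has_real_derivative f' t) (at t)" for t
      using orb' by (auto simp: oscillator_orbit_def)
    have i': "set_integrable lborel {0..} (\<lambda>t. cos (w * t) * f t)" 
       "set_integrable lborel {0..} (\<lambda>t. cos (w * t) * f' t)" 
       "set_integrable lborel {0..} (\<lambda>t. sin (w * t) * f t)" 
       "set_integrable lborel {0..} (\<lambda>t. sin (w * t) * f' t)" 
      by (rule oscillator_orbit_integrable[OF zc orb', where D = 1]; auto intro!: continuous_intros)+
    have l': "((\<lambda>t. cos (w * t) * f t) \<longlongrightarrow> 0) at_top" "((\<lambda>t. sin (w * t) * f t) \<longlongrightarrow> 0) at_top"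
      by (rule Lim_null_comparison[OF _ tendsto_rabs_zero[OF l(1)]], simp add: abs_mult mult_left_le_one_le)+
    have "(LINT t:{0..}|lborel. cos (w * t) * f' t - w * (sin (w * t) * f t)) = 0 - cos (w * 0) * f 0"
      by (intro set_integral_FTC_Ici[where F = "\<lambda>t. cos (w * t) * f t"] set_integral_diff set_integrable_mult_right i' l')
        (auto intro!: derivative_eq_intros d continuous_intros c')
    then show "(LINT t:{0..}|lborel. cos (w * t) * f' t) = - f 0 + w * (LINT t:{0..}|lborel. sin (w * t) * f t)"
      by (simp add: set_integral_diff i' set_integrable_mult_right)
    have "(LINT t:{0..}|lborel. sin (w * t) * f' t + w * (cos (w * t) * f t)) = 0 - sin (w * 0) * f 0"
      by (intro set_integral_FTC_Ici[where F = "\<lambda>t. sin (w * t) * f t"] set_integral_add set_integrable_mult_right i' l')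
        (auto intro!: derivative_eq_intros d continuous_intros c')
    then show "(LINT t:{0..}|lborel. sin (w * t) * f' t) = - w * (LINT t:{0..}|lborel. cos (w * t) * f t)"
      by (simp add: set_integral_add i' set_integrable_mult_right)
  qed
  note P = parts[OF orb] and Q = parts[OF oscillator_orbit_derivative[OF orb]]
  have "(LINT t:{0..}|lborel. b t * (- c\<^sup>2 * p t - 2 * z * q t)) =
      - c\<^sup>2 * (LINT t:{0..}|lborel. b t * p t) - 2 * z * (LINT t:{0..}|lborel. b t * q t)"
    if "set_integrable lborel {0..} (\<lambda>t. b t * p t)" "set_integrable lborel {0..} (\<lambda>t. b t * q t)" for b
  proof -
    have "(LINT t:{0..}|lborel. b t * (- c\<^sup>2 * p t - 2 * z * q t)) =
      (LINT t:{0..}|lborel. - c\<^sup>2 * (b t * p t) - 2 * z * (b t * q t))"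
      by (simp add: algebra_simps)
    also have "\<dots> = - c\<^sup>2 * (LINT t:{0..}|lborel. b t * p t) - 2 * z * (LINT t:{0..}|lborel. b t * q t)"
      by (simp only: set_integral_diff that set_integrable_mult_right set_integral_mult_right)
    finally show ?thesis .
  qed
  note split = this[OF i(1,2)] this[OF i(3,4)]
  have e: "Cq = - p 0 + w * Sp" "Sq = - w * Cp"
      "- c\<^sup>2 * Cp - 2 * z * Cq = - q 0 + w * Sq"
      "- c\<^sup>2 * Sp - 2 * z * Sq = - w * Cq"
    using P Q unfolding split by (simp_all add: defs)
  have e1: "(w\<^sup>2 - c\<^sup>2) * Sq + 2 * z * w * Cq = w * q 0"
    using e(2,3) by algebra
  have e2: "(w\<^sup>2 - c\<^sup>2) * Cq - 2 * z * w * Sq = c\<^sup>2 * p 0"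
    using e(1,4) by algebra
  \<comment> \<open>Cramer's rule for \<open>e1\<close> and \<open>e2\<close>.\<close>
  have "Cq * D = 2 * z * w * (w * q 0) + (w\<^sup>2 - c\<^sup>2) * (c\<^sup>2 * p 0)"
    unfolding e1[symmetric] e2[symmetric] D_def by (simp add: algebra_simps power2_eq_square)
  then have Cq: "Cq = (2 * z * w\<^sup>2 * q 0 + (w\<^sup>2 - c\<^sup>2) * c\<^sup>2 * p 0) / D"
    using \<open>D > 0\<close> by (simp add: field_simps power2_eq_square)
  \<comment> \<open>By \<open>Q(1)\<close> the second integral equals \<open>- q 0 + w * Sq\<close>,
    so the sine transform of \<open>q\<close> is what it still requires.\<close>
  have "Sq * D = (w\<^sup>2 - c\<^sup>2) * (w * q 0) - 2 * z * w * (c\<^sup>2 * p 0)"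
    unfolding e1[symmetric] e2[symmetric] D_def by (simp add: algebra_simps power2_eq_square)
  then have "w * Sq * D = w\<^sup>2 * (w\<^sup>2 - c\<^sup>2) * q 0 - 2 * z * w\<^sup>2 * c\<^sup>2 * p 0"
    by algebra
  then have "w * Sq = (w\<^sup>2 * (w\<^sup>2 - c\<^sup>2) * q 0 - 2 * z * w\<^sup>2 * c\<^sup>2 * p 0) / D"
    using \<open>D > 0\<close> by (simp add: nonzero_eq_divide_eq)
  with Cq Q(1) show "(LINT t:{0..}|lborel. cos (w * t) * q t) =
      (2 * z * w\<^sup>2 * q 0 + (w\<^sup>2 - c\<^sup>2) * c\<^sup>2 * p 0) / ((c\<^sup>2 - w\<^sup>2)\<^sup>2 + 4 * z\<^sup>2 * w\<^sup>2)"
    "(LINT t:{0..}|lborel. cos (w * t) * (- c\<^sup>2 * p t - 2 * z * q t)) = 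
      - q 0 + (w\<^sup>2 * (w\<^sup>2 - c\<^sup>2) * q 0 - 2 * z * w\<^sup>2 * c\<^sup>2 * p 0) / ((c\<^sup>2 - w\<^sup>2)\<^sup>2 + 4 * z\<^sup>2 * w\<^sup>2)"
    by (simp_all add: defs D_def)
qed

section \<open>Matrix-valued integrals\<close>

text \<open>The function is the finite sum of its coordinates embedded along the axes, and each
  embedding is bounded linear.\<close>

lemma integrable_vecI:
  fixes f :: "'a \<Rightarrow> 'b::euclidean_space^'n"
  assumes "\<And>i. integrable M (\<lambda>x. f x $ i)"
  shows "integrable M f"
proof -
  have "bounded_linear (axis i :: 'b \<Rightarrow> 'b^'n)" for i
    unfolding linear_conv_bounded_linear[symmetric]
    by (rule linearI) (simp_all add: axis_def vec_eq_iff)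
  then have "integrable M (\<lambda>x. \<Sum>i\<in>UNIV. axis i (f x $ i))"
    using assms by (intro Bochner_Integration.integrable_sum integrable_bounded_linear[of "axis _"])
  moreover have "(\<Sum>i\<in>UNIV. axis i (f x $ i)) = f x" for x
    by (simp add: vec_eq_iff axis_def)
  ultimately show ?thesis by simp
qed

lemma set_integrable_matrixI:
  fixes f :: "'a \<Rightarrow> real^'n^'m"
  assumes "\<And>i j. set_integrable M S (\<lambda>x. f x $ i $ j)"
  shows "set_integrable M S f"
  using assms unfolding set_integrable_def
  by (intro integrable_vecI) simp

lemma set_integral_bounded_linear:
  fixes f :: "'a \<Rightarrow> 'b::{banach,second_countable_topology}"
    and T :: "'b \<Rightarrow> 'c::{banach,second_countable_topology}"
  assumes "bounded_linear T" "set_integrable M S f"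
  shows "(LINT x:S|M. T (f x)) = T (LINT x:S|M. f x)"
  using integral_bounded_linear[OF assms[unfolded set_integrable_def]]
  by (simp add: set_lebesgue_integral_def linear_simps(5)[OF assms(1)])

text \<open>With both matrices equal to the exponential, the covariance integrand becomes the outer
  product of the orbit of \<open>B\<close> with itself.\<close>

lemma outer_product_congruence:
  fixes P Q :: "real^'n^'n"
  shows "P ** outer_product x y ** transpose Q = outer_product (P *v x) (Q *v y)"
  by (simp add: vec_eq_iff outer_product_def matrix_matrix_mult_def matrix_vector_mult_def
      transpose_def sum_product sum_distrib_left sum_distrib_right mult_ac)

lemma matrix_entry_eq:
  fixes P :: "real^'n^'m"
  shows "P $ i $ j = (P *v axis j 1) $ i"
  by (simp add: matrix_vector_mult_basis column_def)

section \<open>The companion matrix of the oscillator and the evaluation of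
  \<open>lambda2\<close>\<close>

definition oscillator_matrix :: "real \<Rightarrow> real \<Rightarrow> real^2^2" where
  "oscillator_matrix z c = vector [vector [0, 1], vector [- (c\<^sup>2), - 2 * z]]"

lemma oscillator_matrix_mult_vec:
  "(oscillator_matrix z c *v x) $ 1 = x $ 2"
  "(oscillator_matrix z c *v x) $ 2 = - c\<^sup>2 * x $ 1 - 2 * z * x $ 2"
  by (simp_all add: oscillator_matrix_def matrix_vector_mult_def sum_2)

lemma oscillator_orbit_matrix_exp:
  "oscillator_orbit z c (\<lambda>t. (matrix_exp (t *\<^sub>R oscillator_matrix z c) *v x) $ 1)
     (\<lambda>t. (matrix_exp (t *\<^sub>R oscillator_matrix z c) *v x) $ 2)"
  using matrix_exp_vec_has_derivative[where A = "oscillator_matrix z c"]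
  unfolding oscillator_orbit_def
  by (metis oscillator_matrix_mult_vec)

lemma set_integrable_cos_matrix_exp:
  assumes zc: "z > 0" "c > 0"
  shows "set_integrable lborel {0..} (\<lambda>t. cos (w * t) *\<^sub>R matrix_exp (t *\<^sub>R oscillator_matrix z c))"
proof (rule set_integrable_matrixI)
  fix i j :: 2
  show "set_integrable lborel {0..}
      (\<lambda>t. (cos (w * t) *\<^sub>R matrix_exp (t *\<^sub>R oscillator_matrix z c)) $ i $ j)"
    using oscillator_orbit_integrable[OF zc oscillator_orbit_matrix_exp[of z c "axis j 1"],
        of "\<lambda>t. cos (w * t)" 1] exhaust_2[of i]
    by (auto simp: matrix_entry_eq continuous_intros)
qed

lemma inner_S_hat_oscillator:
  assumes zc: "z > 0" "c > 0"
  shows "a \<bullet> (S_hat (oscillator_matrix z c) w *v x) =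
    1 / pi * (LINT t:{0..}|lborel. cos (w * t) * (a \<bullet> (matrix_exp (t *\<^sub>R oscillator_matrix z c) *v x)))"
proof -
  have "bounded_linear (\<lambda>P :: real^2^2. a \<bullet> (P *v x))"
    by (intro bounded_linear_inner_right_comp bounded_linear_matrix_vector_mult_left)
  from set_integral_bounded_linear[OF this set_integrable_cos_matrix_exp[OF zc]]
  show ?thesis
    by (simp add: S_hat_def scaleR_matrix_vector_assoc[symmetric])
qed

text \<open>The orbit of \<open>B\<close> starts at position 0 with velocity \<nu>, so the entries
  are the quadratic integrals for these initial values. The off-diagonal ones vanish because the
  integral of p q depends on the initial position alone.\<close>

lemma stationary_covariance_oscillator:
  assumes zc: "z > 0" "c > 0"
  shows "stationary_covariance (oscillator_matrix z c) (vector [0, \<nu>]) =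
    vector [vector [\<nu>\<^sup>2 / (4 * z * c\<^sup>2), 0], vector [0, \<nu>\<^sup>2 / (4 * z)]]"
proof -
  define A B where "A = oscillator_matrix z c" and "B = (vector [0, \<nu>] :: real^2)"
  define p q where "p t = (matrix_exp (t *\<^sub>R A) *v B) $ 1" and "q t = (matrix_exp (t *\<^sub>R A) *v B) $ 2" for t
  have orb: "oscillator_orbit z c p q"
    unfolding p_def q_def A_def by (rule oscillator_orbit_matrix_exp)
  have [simp]: "p 0 = 0" "q 0 = \<nu>"
    by (simp_all add: p_def q_def B_def matrix_exp_0_vec)
  note I = oscillator_orbit_quadratic_integrals[OF zc orb]
  define f where "f t = matrix_exp (t *\<^sub>R A) ** outer_product B B ** matrix_exp (t *\<^sub>R transpose A)" for t
  have "transpose (t *\<^sub>R A) = t *\<^sub>R transpose A" for t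
    by (simp add: transpose_def vec_eq_iff)
  then have "f t = outer_product (matrix_exp (t *\<^sub>R A) *v B) (matrix_exp (t *\<^sub>R A) *v B)" for t
    unfolding f_def by (metis transpose_matrix_exp outer_product_congruence)
  then have f: "f t $ 1 $ 1 = p t * p t" "f t $ 1 $ 2 = p t * q t"
    "f t $ 2 $ 1 = p t * q t" "f t $ 2 $ 2 = q t * q t" for t
    by (simp_all add: outer_product_def p_def q_def mult.commute)
  have int: "set_integrable lborel {0..} f"
  proof (rule set_integrable_matrixI)
    fix i j :: 2
    show "set_integrable lborel {0..} (\<lambda>t. f t $ i $ j)"
      using I(4-6) exhaust_2[of i] exhaust_2[of j] by (auto simp: f)
  qed
  have "(LINT t:{0..}|lborel. f t) $ i $ j = (LINT t:{0..}|lborel. f t $ i $ j)" for i j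
  proof -
    have "bounded_linear (\<lambda>P :: real^2^2. P $ i $ j)"
      by (rule bounded_linear_compose[OF bounded_linear_vec_nth bounded_linear_vec_nth])
    from set_integral_bounded_linear[OF this int] show ?thesis by simp
  qed
  then have "(LINT t:{0..}|lborel. f t) = vector [vector [\<nu>\<^sup>2 / (4 * z * c\<^sup>2), 0], vector [0, \<nu>\<^sup>2 / (4 * z)]]"
    using I(1-3) zc by (simp add: vec_eq_iff forall_2 f field_simps)
  then show ?thesis
    by (simp add: stationary_covariance_def f_def A_def B_def)
qed

text \<open>By linearity both terms with \<open>S_hat\<close> act on the single vector
  \<open>x\<close>. The functional \<open>a\<close> reads off the derivative of the velocity
  component, so the second cosine integral applies to the orbit of \<open>x\<close>.\<close>

lemma lambda2_oscillator:
  assumes zc: "z > 0" "c > 0" and w: "w \<noteq> 0"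
  shows "lambda2 (oscillator_matrix z c) (vector [0, \<nu>]) (vector [- (c\<^sup>2), - 2 * z]) \<nu> w
    = w\<^sup>2 * \<nu>\<^sup>2 / (2 * ((c\<^sup>2 - w\<^sup>2)\<^sup>2 + 4 * z\<^sup>2 * w\<^sup>2))"
proof -
  define A B a where "A = oscillator_matrix z c" and "B = (vector [0, \<nu>] :: real^2)"
    and "a = (vector [- (c\<^sup>2), - 2 * z] :: real^2)"
  define R where "R = stationary_covariance A B"
  define x where "x = R *v a + \<nu> *\<^sub>R B"
  define D where "D = (c\<^sup>2 - w\<^sup>2)\<^sup>2 + 4 * z\<^sup>2 * w\<^sup>2"
  have "D > 0" unfolding D_def using zc w by (intro add_nonneg_pos) auto
  have x: "x $ 1 = - \<nu>\<^sup>2 / (4 * z)" "x $ 2 = \<nu>\<^sup>2 / 2"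
    using zc by (simp_all add: x_def R_def A_def B_def a_def stationary_covariance_oscillator
        matrix_vector_mult_def sum_2 field_simps power2_eq_square)
  have "pi * (a \<bullet> (S_hat A w *v x)) = 
      (LINT t:{0..}|lborel. cos (w * t) * (- c\<^sup>2 * (matrix_exp (t *\<^sub>R A) *v x) $ 1 - 2 * z * (matrix_exp (t *\<^sub>R A) *v x) $ 2))"
    unfolding A_def inner_S_hat_oscillator[OF zc] by (simp add: a_def inner_vec_def sum_2)
  also have "\<dots> = - x $ 2 + (w\<^sup>2 * (w\<^sup>2 - c\<^sup>2) * x $ 2 - 2 * z * w\<^sup>2 * c\<^sup>2 * x $ 1) / D"
    using oscillator_orbit_cosine_integrals(2)[OF zc oscillator_orbit_matrix_exp w, of x]
    by (simp add: A_def D_def matrix_exp_0_vec)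
  \<comment> \<open>For these coordinates of \<open>x\<close> the two contributions with c^2 in the
    numerator cancel, leaving a pure fourth power of \<open>w\<close>.\<close>
  also have "\<dots> = - \<nu>\<^sup>2 / 2 + w ^ 4 * \<nu>\<^sup>2 / (2 * D)"
    using zc \<open>D > 0\<close> by (simp add: x field_simps power2_eq_square power4_eq_xxxx)
  finally have *: "a \<bullet> (S_hat A w *v x) = (- \<nu>\<^sup>2 / 2 + w ^ 4 * \<nu>\<^sup>2 / (2 * D)) / pi"
    by (simp add: field_simps)
  have "lambda2 A B a \<nu> w = pi / w\<^sup>2 * (a \<bullet> (S_hat A w *v x) + \<nu>\<^sup>2 / (2 * pi))"
    by (simp add: lambda2_def x_def R_def matrix_vector_right_distrib inner_add_right)
  \<comment> \<open>The white-noise term of \<open>lambda2\<close> cancels the boundary term of the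
    integration by parts.\<close>
  also have "\<dots> = w\<^sup>2 * \<nu>\<^sup>2 / (2 * D)"
    unfolding * using w \<open>D > 0\<close> by (simp add: field_simps power2_eq_square power4_eq_xxxx)
  finally show ?thesis by (simp add: A_def B_def a_def D_def)
qed

section \<open>Riemann--Stieltjes sums along the paths\<close>

text \<open>The increments of \<open>F\<close> telescope, so local errors of at most e times the
  step length add up to at most e times \<open>T\<close>. Deterministic Riemann sums and weighted
  noise sums are both treated this way.\<close>

lemma grid_sum_tendsto:
  fixes F :: "real \<Rightarrow> real" and G :: "real \<Rightarrow> real \<Rightarrow> real"
  assumes T: "T \<ge> 0"
    and approx: "\<And>e. e > 0 \<Longrightarrow> \<exists>d>0. \<forall>a b. 0 \<le> a \<and> a \<le> b \<and> b \<le> T \<and> b - a < d \<longrightarrow>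
      \<bar>F b - F a - G a b\<bar> \<le> e * (b - a)"
  shows "(\<lambda>n. \<Sum>i<Suc n. G (real i * T / real (Suc n)) (real (Suc i) * T / real (Suc n)))
    \<longlonglongrightarrow> F T - F 0"
proof (rule LIMSEQ_I)
  fix e :: real assume e: "e > 0"
  \<comment> \<open>Adding 1 keeps the final estimate strict and admits
    \<open>T = 0\<close>.\<close>
  define e' where "e' = e / (T + 1)"
  have e': "e' > 0" using e T by (simp add: e'_def)
  obtain d where d: "d > 0"
    "\<forall>a b. 0 \<le> a \<and> a \<le> b \<and> b \<le> T \<and> b - a < d \<longrightarrow> \<bar>F b - F a - G a b\<bar> \<le> e' * (b - a)"
    using approx[OF e'] by (elim exE conjE)
  have "(\<lambda>n. T / real (Suc n)) \<longlonglongrightarrow> 0"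
    using LIMSEQ_Suc[OF lim_const_over_n] by simp
  then have "\<forall>\<^sub>F n in sequentially. T / real (Suc n) < d"
    using d(1) by (rule order_tendstoD)
  then obtain N where N: "\<forall>n\<ge>N. T / real (Suc n) < d"
    unfolding eventually_sequentially by blast
  show "\<exists>no. \<forall>n\<ge>no. norm ((\<Sum>i<Suc n. G (real i * T / real (Suc n)) (real (Suc i) * T / real (Suc n))) - (F T - F 0)) < e"
  proof (intro exI allI impI)
    fix n assume n: "n \<ge> N"
    define s where "s i = real i * T / real (Suc n)" for i
    have step: "s (Suc i) - s i = T / real (Suc n)" for i
      unfolding s_def diff_divide_distrib[symmetric] left_diff_distrib[symmetric] by simp
    have "F T - F 0 = (\<Sum>i<Suc n. F (s (Suc i)) - F (s i))"
      unfolding sum_lessThan_telescope[of "\<lambda>i. F (s i)"] by (simp add: s_def)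
    then have "(F T - F 0) - (\<Sum>i<Suc n. G (s i) (s (Suc i))) =
        (\<Sum>i<Suc n. F (s (Suc i)) - F (s i) - G (s i) (s (Suc i)))"
      by (simp only: sum_subtractf)
    also have "\<bar>\<dots>\<bar> \<le> (\<Sum>i<Suc n. e' * (T / real (Suc n)))"
    proof (rule sum_abs[THEN order_trans], rule sum_mono)
      fix i assume i: "i \<in> {..<Suc n}"
      have "s (Suc i) \<le> T"
        using i T mult_right_mono[of "real (Suc i)" "real (Suc n)" T] by (simp add: s_def field_simps)
      moreover have "0 \<le> s i" "s i \<le> s (Suc i)"
        using T step[of i] by (simp_all add: s_def divide_right_mono mult_right_mono)
      ultimately show "\<bar>F (s (Suc i)) - F (s i) - G (s i) (s (Suc i))\<bar> \<le> e' * (T / real (Suc n))"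
        using d(2)[rule_format, of "s i" "s (Suc i)"] N[rule_format, OF n] step by simp
    qed
    also have "\<dots> = e' * T" by simp
    also have "\<dots> < e" using e T by (simp add: e'_def field_simps)
    finally show "norm ((\<Sum>i<Suc n. G (real i * T / real (Suc n)) (real (Suc i) * T / real (Suc n))) - (F T - F 0)) < e"
      by (simp add: s_def)
  qed
qed

text \<open>The factors are evaluated at different points near \<open>a\<close>, since the mean
  value theorem yields a separate intermediate point for each function. A constant second factor
  gives ordinary uniform continuity.\<close>

lemma uniformly_continuous_product:
  fixes f g :: "real \<Rightarrow> real"
  assumes "continuous_on {0..T} f" "continuous_on {0..T} g" "e > 0"
  shows "\<exists>d>0. \<forall>a x y. a \<in> {0..T} \<and> x \<in> {0..T} \<and> y \<in> {0..T} \<and> \<bar>x - a\<bar> < d \<and> \<bar>y - a\<bar> < d \<longrightarrow>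
    \<bar>f x * g y - f a * g a\<bar> < e"
proof -
  let ?S = "{0..T} \<times> {0..T}"
  have "continuous_on ?S (\<lambda>(x, y). f x * g y)"
    unfolding case_prod_beta
    by (intro continuous_intros continuous_on_compose2[OF assms(1)] continuous_on_compose2[OF assms(2)]) auto
  then have "uniformly_continuous_on ?S (\<lambda>(x, y). f x * g y)"
    by (intro compact_uniformly_continuous compact_Times) auto
  then obtain d where d: "d > 0" 
    "\<forall>p\<in>?S. \<forall>q\<in>?S. dist q p < d \<longrightarrow> dist (case q of (x, y) \<Rightarrow> f x * g y) (case p of (x, y) \<Rightarrow> f x * g y) < e"
    using assms(3) unfolding uniformly_continuous_on_def by blast
  have "\<bar>f x * g y - f a * g a\<bar> < e"
    if "a \<in> {0..T}" "x \<in> {0..T}" "y \<in> {0..T}" "\<bar>x - a\<bar> < d/2" "\<bar>y - a\<bar> < d/2" for a x y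
  proof -
    have "dist (x, y) (a, a) \<le> \<bar>x - a\<bar> + \<bar>y - a\<bar>"
      using sqrt_sum_squares_le_sum_abs[of "x - a" "y - a"] by (simp add: dist_Pair_Pair dist_real_def)
    then show ?thesis
      using d(2)[rule_format, of "(a, a)" "(x, y)"] that by (simp add: dist_real_def)
  qed
  then show ?thesis using d(1) by (intro exI[of _ "d/2"]) auto
qed

text \<open>On each step the mean value theorem turns the error into an oscillation of
  \<open>f\<close> times the step length. This will give the limiting variance of the noise
  sums.\<close>

lemma grid_riemann_sum_tendsto:
  fixes F f :: "real \<Rightarrow> real"
  assumes T: "T \<ge> 0" and F: "\<And>t. (F has_real_derivative f t) (at t)" and f: "continuous_on UNIV f"
  shows "(\<lambda>n. \<Sum>i<Suc n. f (real i * T / real (Suc n)) * (real (Suc i) * T / real (Suc n) - real i * T / real (Suc n)))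
    \<longlonglongrightarrow> F T - F 0"
proof (rule grid_sum_tendsto[OF T, where G = "\<lambda>a b. f a * (b - a)"])
  fix e :: real assume "e > 0"
  have "\<exists>d>0. \<forall>a x y. a \<in> {0..T} \<and> x \<in> {0..T} \<and> y \<in> {0..T} \<and> \<bar>x - a\<bar> < d \<and> \<bar>y - a\<bar> < d \<longrightarrow>
    \<bar>f x * 1 - f a * 1\<bar> < e"
    using \<open>e > 0\<close> continuous_on_subset[OF f]
    by (intro uniformly_continuous_product[where g = "\<lambda>_. 1"]) auto
  then obtain d where "d > 0" and d': "\<forall>a x y. a \<in> {0..T} \<and> x \<in> {0..T} \<and> y \<in> {0..T} \<and> \<bar>x - a\<bar> < d \<and> \<bar>y - a\<bar> < d \<longrightarrow>
    \<bar>f x * 1 - f a * 1\<bar> < e"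
    by blast
  have d: "d > 0" "\<And>a x. a \<in> {0..T} \<Longrightarrow> x \<in> {0..T} \<Longrightarrow> \<bar>x - a\<bar> < d \<Longrightarrow> \<bar>f x - f a\<bar> < e"
    using \<open>d > 0\<close> d'[rule_format, of a x x for a x] by simp_all
  have "\<bar>F b - F a - f a * (b - a)\<bar> \<le> e * (b - a)" if "0 \<le> a" "a \<le> b" "b \<le> T" "b - a < d" for a b
  proof -
    have "\<exists>x\<in>{a..b}. F b - F a = (*) (f x) (b - a)"
      using F by (intro mvt_very_simple that) (auto simp: has_field_derivative_def intro: has_derivative_at_withinI)
    then obtain x where x: "x \<in> {a..b}" "F b - F a = f x * (b - a)" by auto
    then have "F b - F a - f a * (b - a) = (f x - f a) * (b - a)" by (simp add: algebra_simps)
    moreover have "\<bar>f x - f a\<bar> \<le> e" using d(2)[of a x] x that by force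
    ultimately show ?thesis using that by (simp add: abs_mult mult_right_mono)
  qed
  then show "\<exists>d>0. \<forall>a b. 0 \<le> a \<and> a \<le> b \<and> b \<le> T \<and> b - a < d \<longrightarrow> \<bar>F b - F a - f a * (b - a)\<bar> \<le> e * (b - a)"
    using d(1) by blast
qed

text \<open>The pair \<open>(P, Q)\<close> solves the adjoint equation, so \<open>P x + Q y\<close> is driven by the noise alone.\<close>

lemma grid_stochastic_sum_tendsto:
  fixes x y w P Q :: "real \<Rightarrow> real"
  assumes T: "T \<ge> 0"
    and y: "continuous_on {0..} y"
    and x: "\<And>t. t \<ge> 0 \<Longrightarrow> (x has_real_derivative y t) (at t within {0..})"
    and eq: "\<And>t. t \<ge> 0 \<Longrightarrow> y t - y 0 + integral {0..t} (\<lambda>s. 2 * z * y s + c\<^sup>2 * x s) = \<nu> * (w t - w 0)"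
    and P: "\<And>t. (P has_real_derivative c\<^sup>2 * Q t) (at t)"
    and Q: "\<And>t. (Q has_real_derivative 2 * z * Q t - P t) (at t)"
  shows "(\<lambda>n. \<Sum>i<Suc n. \<nu> * Q (real i * T / real (Suc n)) * (w (real (Suc i) * T / real (Suc n)) - w (real i * T / real (Suc n))))
    \<longlonglongrightarrow> (P T * x T + Q T * y T) - (P 0 * x 0 + Q 0 * y 0)"
proof (rule grid_sum_tendsto[OF T, where F = "\<lambda>s. P s * x s + Q s * y s" and G = "\<lambda>a b. \<nu> * Q a * (w b - w a)"])
  \<comment> \<open>\<open>k\<close> is the restoring and damping term of the equation,
    \<open>u\<close> the derivative of P x, and \<open>m\<close> the derivative of
    \<open>Q\<close>.\<close>
  define k where "k s = 2 * z * y s + c\<^sup>2 * x s" for s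
  define u where "u s = c\<^sup>2 * Q s * x s + P s * y s" for s
  define m where "m s = 2 * z * Q s - P s" for s
  have x_cont: "continuous_on {0..} x"
    using x by (auto simp: continuous_on_eq_continuous_within intro!: DERIV_continuous)
  have PQ_cont: "continuous_on S P" "continuous_on S Q" for S
    using P Q by (auto intro!: continuous_at_imp_continuous_on DERIV_isCont)
  have sub: "continuous_on {0..T} x" "continuous_on {0..T} y"
    using x_cont y by (auto elim: continuous_on_subset)
  have conts: "continuous_on {0..T} k" "continuous_on {0..T} u" "continuous_on {0..T} m"
    unfolding k_def u_def m_def by (intro continuous_intros sub PQ_cont)+
  fix e :: real assume e: "e > 0"
  then have e3: "e/3 > 0" by simp
  obtain d1 where d1: "d1 > 0" "\<forall>a x y. a \<in> {0..T} \<and> x \<in> {0..T} \<and> y \<in> {0..T} \<and> \<bar>x - a\<bar> < d1 \<and> \<bar>y - a\<bar> < d1 \<longrightarrow>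
    \<bar>u x * 1 - u a * 1\<bar> < e/3"
    using uniformly_continuous_product[OF conts(2) continuous_on_const[of _ 1] e3] by blast
  obtain d2 where d2: "d2 > 0" "\<forall>a s t. a \<in> {0..T} \<and> s \<in> {0..T} \<and> t \<in> {0..T} \<and> \<bar>s - a\<bar> < d2 \<and> \<bar>t - a\<bar> < d2 \<longrightarrow>
    \<bar>m s * y t - m a * y a\<bar> < e/3"
    using uniformly_continuous_product[OF conts(3) sub(2) e3] by blast
  obtain d3 where d3: "d3 > 0" "\<forall>a x y. a \<in> {0..T} \<and> x \<in> {0..T} \<and> y \<in> {0..T} \<and> \<bar>x - a\<bar> < d3 \<and> \<bar>y - a\<bar> < d3 \<longrightarrow>
    \<bar>Q x * k y - Q a * k a\<bar> < e/3"
    using uniformly_continuous_product[OF PQ_cont(2) conts(1) e3] by blast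
  define d where "d = min d1 (min d2 d3)"
  have "\<bar>(P b * x b + Q b * y b) - (P a * x a + Q a * y a) - \<nu> * Q a * (w b - w a)\<bar> \<le> e * (b - a)"
    if ab: "0 \<le> a" "a \<le> b" "b \<le> T" "b - a < d" for a b
  proof -
    have within: "(x has_real_derivative y s) (at s within {a..b})" if "s \<in> {a..b}" for s
      using x[of s] that ab by (auto elim: has_field_derivative_subset)
    have "((\<lambda>s. P s * x s) has_real_derivative u s) (at s within {a..b})" if "s \<in> {a..b}" for s
      using within[OF that] P[of s, THEN has_field_derivative_at_within, of "{a..b}"]
      by (auto intro!: derivative_eq_intros simp: u_def algebra_simps)
    then have "\<exists>s\<in>{a..b}. P b * x b - P a * x a = (*) (u s) (b - a)"
      by (intro mvt_very_simple ab) (auto simp: has_field_derivative_def)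
    then obtain s1 where s1: "s1 \<in> {a..b}" "P b * x b - P a * x a = u s1 * (b - a)" by auto
    have "\<exists>s\<in>{a..b}. Q b - Q a = (*) (m s) (b - a)"
      using Q by (intro mvt_very_simple ab) (auto simp: has_field_derivative_def m_def intro: has_derivative_at_withinI)
    then obtain s2 where s2: "s2 \<in> {a..b}" "Q b - Q a = m s2 * (b - a)" by auto
    have "((\<lambda>s. integral {0..s} k) has_real_derivative k s) (at s within {a..b})" if "s \<in> {a..b}" for s
      using integral_has_real_derivative[OF conts(1), of s] that ab
      by (auto elim: has_field_derivative_subset)
    then have "\<exists>s\<in>{a..b}. integral {0..b} k - integral {0..a} k = (*) (k s) (b - a)"
      by (intro mvt_very_simple ab) (auto simp: has_field_derivative_def)
    then obtain s3 where s3: "s3 \<in> {a..b}" "integral {0..b} k - integral {0..a} k = k s3 * (b - a)" by auto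
    \<comment> \<open>The path \<open>y\<close> need not be differentiable, so there is no mean
      value theorem for Q y. Its increment is split in two, and that of \<open>y\<close> is taken
      from the integrated equation.\<close>
    have "\<nu> * (w b - w a) = y b - y a + (integral {0..b} k - integral {0..a} k)"
      using eq[of a] eq[of b] ab unfolding k_def by (simp add: algebra_simps)
    then have "(P b * x b + Q b * y b) - (P a * x a + Q a * y a) - \<nu> * Q a * (w b - w a) =
      (P b * x b - P a * x a) + (Q b - Q a) * y b - Q a * (integral {0..b} k - integral {0..a} k)"
      by algebra
    also have "\<dots> = (u s1 + m s2 * y b - Q a * k s3) * (b - a)"
      unfolding s1 s2 s3 by (simp add: algebra_simps)
    \<comment> \<open>At the common point \<open>a\<close> the three terms sum to zero; this is
      where the adjoint equation enters. Only oscillations over a short interval remain.\<close>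
    also have "u s1 + m s2 * y b - Q a * k s3 = 
       (u s1 - u a) + (m s2 * y b - m a * y a) - (Q a * k s3 - Q a * k a)"
      by (simp add: u_def m_def k_def algebra_simps)
    finally have *: "(P b * x b + Q b * y b) - (P a * x a + Q a * y a) - \<nu> * Q a * (w b - w a) =
      ((u s1 - u a) + (m s2 * y b - m a * y a) - (Q a * k s3 - Q a * k a)) * (b - a)" .
    have "\<bar>u s1 - u a\<bar> < e/3" using d1(2)[rule_format, of a s1 s1] s1(1) ab by (auto simp: d_def)
    moreover have "\<bar>m s2 * y b - m a * y a\<bar> < e/3" using d2(2)[rule_format, of a s2 b] s2(1) ab by (auto simp: d_def)
    moreover have "\<bar>Q a * k s3 - Q a * k a\<bar> < e/3" using d3(2)[rule_format, of a a s3] s3(1) ab by (auto simp: d_def)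
    ultimately have "\<bar>(u s1 - u a) + (m s2 * y b - m a * y a) - (Q a * k s3 - Q a * k a)\<bar> \<le> e"
      by linarith
    then show ?thesis
      unfolding * abs_mult using ab by (simp add: mult_right_mono)
  qed
  then show "\<exists>d>0. \<forall>a b. 0 \<le> a \<and> a \<le> b \<and> b \<le> T \<and> b - a < d \<longrightarrow>
      \<bar>(P b * x b + Q b * y b) - (P a * x a + Q a * y a) - \<nu> * Q a * (w b - w a)\<bar> \<le> e * (b - a)"
    using d1 d2 d3 by (intro exI[of _ d]) (auto simp: d_def)
qed

section \<open>Characteristic functions and independence\<close>

lemma char_distr:
  assumes "X \<in> borel_measurable M"
  shows "char (distr M borel X) t = (CLINT x|M. iexp (t * X x))"
  using assms by (simp add: char_def integral_distr)

lemma char_distr_mult: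
  fixes X :: "'a \<Rightarrow> real"
  assumes [measurable]: "X \<in> borel_measurable M"
  shows "char (distr M borel (\<lambda>x. k * X x)) t = char (distr M borel X) (k * t)"
  by (simp add: char_distr mult_ac)

lemma char_distr_normal:
  assumes "prob_space M" "\<sigma> > 0" and X: "distributed M lborel X (normal_density 0 \<sigma>)"
  shows "char (distr M borel X) t = exp (- (\<sigma> * t)\<^sup>2 / 2)"
proof -
  interpret prob_space M by fact
  have [measurable]: "X \<in> borel_measurable M"
    using distributed_measurable[OF X] by simp
  have Z: "distributed M lborel (\<lambda>x. (X x - 0) / \<sigma>) std_normal_density"
    using X normal_standard_normal_convert[OF \<open>\<sigma> > 0\<close>, of X 0] by simp
  have "distr M borel (\<lambda>x. (X x - 0) / \<sigma>) = distr M lborel (\<lambda>x. (X x - 0) / \<sigma>)"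
    by (rule distr_cong) simp_all
  then have "distr M borel (\<lambda>x. X x / \<sigma>) = std_normal_distribution"
    using distributed_distr_eq_density[OF Z] by simp
  then have "char (distr M borel (\<lambda>x. X x / \<sigma>)) (\<sigma> * t) = exp (- (\<sigma> * t)\<^sup>2 / 2)"
    by (simp add: char_std_normal_distribution)
  then show ?thesis
    using \<open>\<sigma> > 0\<close> by (simp add: char_distr)
qed

text \<open>The integrands have modulus one, so dominated convergence needs only the constant bound
  1 and no moments.\<close>

lemma char_distr_tendsto:
  fixes X :: "nat \<Rightarrow> 'a \<Rightarrow> real"
  assumes "prob_space M" and [measurable]: "\<And>n. X n \<in> borel_measurable M" "Y \<in> borel_measurable M"
    and lim: "AE x in M. (\<lambda>n. X n x) \<longlonglongrightarrow> Y x"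
  shows "(\<lambda>n. char (distr M borel (X n)) t) \<longlonglongrightarrow> char (distr M borel Y) t"
proof -
  interpret prob_space M by fact
  show ?thesis
    unfolding char_distr[OF assms(2)] char_distr[OF assms(3)]
  proof (rule integral_dominated_convergence[where w = "\<lambda>_. 1"])
    show "AE x in M. (\<lambda>n. iexp (t * X n x)) \<longlonglongrightarrow> iexp (t * Y x)"
      using lim by eventually_elim (intro tendsto_intros)
  qed auto
qed

text \<open>By Levy uniqueness the law is that of \<open>sqrt K\<close> times a standard normal
  variable. Square integrability is thus a conclusion about \<open>X\<close>.\<close>

lemma second_moment_of_gaussian_char:
  assumes "prob_space M" and X[measurable]: "X \<in> borel_measurable M"
    and char: "\<And>t. char (distr M borel X) t = exp (- K * t\<^sup>2 / 2)"
  shows "integrable M (\<lambda>x. (X x)\<^sup>2)" "(\<integral>x. (X x)\<^sup>2 \<partial>M) = K"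
proof -
  interpret prob_space M by fact
  interpret X: real_distribution "distr M borel X" by (rule real_distribution_distr) simp
  interpret N: real_distribution std_normal_distribution by (rule real_dist_normal_dist)
  \<comment> \<open>Nonnegativity of \<open>K\<close> is forced by the modulus bound on
    characteristic functions.\<close>
  have "norm (char (distr M borel X) 1) \<le> 1" by (rule X.cmod_char_le_1)
  then have "exp (- K / 2) \<le> 1" by (simp add: char)
  then have K: "K \<ge> 0" by simp
  have "char (distr std_normal_distribution borel (\<lambda>x. sqrt K * x)) t = char std_normal_distribution (sqrt K * t)" for t
    by (subst char_distr) (simp_all add: char_def mult_ac)
  then have "char (distr std_normal_distribution borel (\<lambda>x. sqrt K * x)) = char (distr M borel X)"
    using K by (simp add: fun_eq_iff char char_std_normal_distribution power_mult_distrib)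
  then have eq: "distr std_normal_distribution borel (\<lambda>x. sqrt K * x) = distr M borel X"
    by (intro Levy_uniqueness N.real_distribution_distr) (simp_all add: real_distribution_distr)
  have "integrable std_normal_distribution (\<lambda>x. (sqrt K * x)\<^sup>2)"
    unfolding power_mult_distrib by (intro integrable_mult_right integrable_std_normal_distribution_moment)
  then have "integrable (distr std_normal_distribution borel (\<lambda>x. sqrt K * x)) (\<lambda>x. x\<^sup>2)"
    by (subst integrable_distr_eq) auto
  then show "integrable M (\<lambda>x. (X x)\<^sup>2)"
    unfolding eq by (subst (asm) integrable_distr_eq) auto
  have "(\<integral>x. (X x)\<^sup>2 \<partial>M) = (\<integral>x. x\<^sup>2 \<partial>distr M borel X)"
    by (simp add: integral_distr)
  also have "\<dots> = (\<integral>x. (sqrt K * x)\<^sup>2 \<partial>std_normal_distribution)"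
    unfolding eq[symmetric] by (subst integral_distr) auto
  also have "\<dots> = K * (\<integral>x. x\<^sup>2 \<partial>std_normal_distribution)"
    using K by (simp add: power_mult_distrib)
  also have "(\<integral>x. x\<^sup>2 \<partial>std_normal_distribution) = 1"
    using std_normal_distribution_even_moments(1)[of 1] by (simp add: fact_numeral)
  finally show "(\<integral>x. (X x)\<^sup>2 \<partial>M) = K" by simp
qed

text \<open>Independence of the increments factorizes the characteristic function. Strict
  monotonicity of \<tau> makes every variance positive, as the normal density requires.\<close>

lemma char_brownian_increment_sum:
  assumes W: "standard_brownian_motion M W" and \<tau>: "strict_mono \<tau>" "0 \<le> \<tau> 0"
  shows "char (distr M borel (\<lambda>x. \<Sum>i<n. k i * (W (\<tau> (Suc i)) x - W (\<tau> i) x))) t =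
    exp (- (\<Sum>i<n. (k i)\<^sup>2 * (\<tau> (Suc i) - \<tau> i)) * t\<^sup>2 / 2)"
proof -
  interpret prob_space M using W by (simp add: standard_brownian_motion_def)
  have pos: "0 \<le> \<tau> i" for i
    using \<tau> monoD[OF strict_mono_mono[OF \<tau>(1)], of 0 i] by simp
  have lt: "\<tau> i < \<tau> (Suc i)" for i using \<tau>(1) by (simp add: strict_mono_def)
  have [measurable]: "W (\<tau> i) \<in> borel_measurable M" for i
    using W pos by (simp add: standard_brownian_motion_def)
  have "indep_vars (\<lambda>_. borel) (\<lambda>i x. W (\<tau> (Suc i)) x - W (\<tau> i) x) {..<n}"
    using W \<tau>(2) strict_mono_mono[OF \<tau>(1)] by (simp add: standard_brownian_motion_def)
  then have "indep_vars (\<lambda>_. borel) (\<lambda>i x. k i * (W (\<tau> (Suc i)) x - W (\<tau> i) x)) {..<n}"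
    by (rule indep_vars_compose2[where Y = "\<lambda>i x. k i * x"]) simp
  then have "char (distr M borel (\<lambda>x. \<Sum>i<n. k i * (W (\<tau> (Suc i)) x - W (\<tau> i) x))) t =
      (\<Prod>i<n. char (distr M borel (\<lambda>x. k i * (W (\<tau> (Suc i)) x - W (\<tau> i) x))) t)"
    by (rule char_distr_sum)
  also have "\<dots> = (\<Prod>i<n. complex_of_real (exp (- ((k i)\<^sup>2 * (\<tau> (Suc i) - \<tau> i)) * t\<^sup>2 / 2)))"
  proof (rule prod.cong[OF refl])
    fix i
    have "distributed M lborel (\<lambda>x. W (\<tau> (Suc i)) x - W (\<tau> i) x)
        (normal_density 0 (sqrt (\<tau> (Suc i) - \<tau> i)))"
      using W pos[of i] lt[of i] by (simp add: standard_brownian_motion_def)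
    from char_distr_normal[OF prob_space_axioms _ this, of "k i * t"]
    show "char (distr M borel (\<lambda>x. k i * (W (\<tau> (Suc i)) x - W (\<tau> i) x))) t =
        exp (- ((k i)\<^sup>2 * (\<tau> (Suc i) - \<tau> i)) * t\<^sup>2 / 2)"
      using lt[of i] by (subst char_distr_mult) (simp_all add: power_mult_distrib mult_ac)
  qed
  also have "\<dots> = exp (- (\<Sum>i<n. (k i)\<^sup>2 * (\<tau> (Suc i) - \<tau> i)) * t\<^sup>2 / 2)"
    by (simp add: exp_sum[symmetric] sum_negf[symmetric] sum_distrib_right sum_divide_distrib
        of_real_prod[symmetric] del: of_real_prod)
  finally show ?thesis .
qed

section \<open>Generated sigma-algebras and independence from the noise\<close>

lemma sets_vimage_algebra_compose:
  assumes Z: "Z \<in> \<Omega> \<rightarrow> space N" and F: "F \<in> measurable N L"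
  shows "sets (vimage_algebra \<Omega> (\<lambda>x. F (Z x)) L) \<subseteq> sets (vimage_algebra \<Omega> Z N)"
proof -
  have FZ: "(\<lambda>x. F (Z x)) \<in> \<Omega> \<rightarrow> space L"
    using Z measurable_space[OF F] by auto
  show ?thesis
    unfolding sets_vimage_algebra2[OF Z] sets_vimage_algebra2[OF FZ]
  proof safe
    fix A assume "A \<in> sets L"
    then have "F -` A \<inter> space N \<in> sets N" using F by (rule measurable_sets[rotated])
    moreover have "(\<lambda>x. F (Z x)) -` A \<inter> \<Omega> = Z -` (F -` A \<inter> space N) \<inter> \<Omega>"
      using Z by auto
    ultimately show "\<exists>B. (\<lambda>x. F (Z x)) -` A \<inter> \<Omega> = Z -` B \<inter> \<Omega> \<and> B \<in> sets N" by blast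
  qed
qed

lemma (in prob_space) indep_set_subset:
  assumes "indep_set A B" "A' \<subseteq> A" "B' \<subseteq> B"
  shows "indep_set A' B'"
  unfolding indep_set_def
  by (rule indep_sets_mono_sets[OF assms(1)[unfolded indep_set_def]])
    (use assms(2,3) in \<open>simp split: bool.split\<close>)

text \<open>Carries independence from the pair of initial values to the initial vector of the
  first-order system.\<close>

lemma independent_of_noise_compose:
  assumes "prob_space M" "independent_of_noise M W Z" "f \<in> borel_measurable borel"
  shows "independent_of_noise M W (\<lambda>x. f (Z x))"
proof -
  interpret prob_space M by fact
  show ?thesis
    using assms(2) unfolding independent_of_noise_def
    by (rule indep_set_subset) (rule sets_vimage_algebra_compose, simp_all add: assms(3))
qed

text \<open>Applying measurable functions only shrinks the generated sigma-algebras. A finite sum of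
  Brownian increments is such a functional of the whole path.\<close>

lemma indep_var_noise_functional:
  assumes "prob_space M" "independent_of_noise M W Z"
    and Z: "Z \<in> borel_measurable M" and W: "\<And>t. t \<ge> 0 \<Longrightarrow> W t \<in> borel_measurable M"
    and f: "f \<in> borel_measurable borel"
    and F: "F \<in> borel_measurable (\<Pi>\<^sub>M t\<in>{0..}. borel)"
  shows "prob_space.indep_var M borel (\<lambda>x. f (Z x)) borel (\<lambda>x. F (\<lambda>t\<in>{0..}. W t x))"
proof -
  interpret prob_space M by fact
  let ?W = "\<lambda>x. \<lambda>t\<in>{0..}. W t x"
  have [measurable]: "?W \<in> measurable M (\<Pi>\<^sub>M t\<in>{0..}. borel)"
    by (rule measurable_restrict) (simp add: W)
  show ?thesis
    unfolding indep_var_eq sets_vimage_algebra[symmetric]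
  proof (intro conjI)
    show "random_variable borel (\<lambda>x. f (Z x))" "random_variable borel (\<lambda>x. F (?W x))"
      using Z f F by measurable
    show "indep_set (sets (vimage_algebra (space M) (\<lambda>x. f (Z x)) borel))
        (sets (vimage_algebra (space M) (\<lambda>x. F (?W x)) borel))"
      using assms(2) unfolding independent_of_noise_def
      by (rule indep_set_subset) (intro sets_vimage_algebra_compose f F; auto simp: space_PiM split: if_splits)+
  qed
qed

section \<open>The stationary process\<close>

text \<open>The pair \<open>g\<close>, \<open>h\<close> is the impulse response and its derivative:
  the orbit released from position 0 with velocity 1.\<close>

locale stationary_oscillator = prob_space M for M :: "'w measure" +
  fixes W \<eta> \<eta>' :: "real \<Rightarrow> 'w \<Rightarrow> real" and z c \<nu> :: real and g h :: "real \<Rightarrow> real"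
  assumes zc: "z > 0" "c > 0"
    and W: "standard_brownian_motion M W"
    and sol: "oscillator_solution M W z c \<nu> \<eta> \<eta>'"
    and stat: "strictly_stationary M \<eta>"
    and orb: "oscillator_orbit z c g h"
    and init: "g 0 = 0" "h 0 = 1"
begin

lemma measurable_processes:
  assumes "t \<ge> 0"
  shows "\<eta> t \<in> borel_measurable M" "\<eta>' t \<in> borel_measurable M" "W t \<in> borel_measurable M"
  using assms sol W by (simp_all add: oscillator_solution_def standard_brownian_motion_def)

lemma measurable_at_0 [measurable]: "\<eta> 0 \<in> borel_measurable M" "\<eta>' 0 \<in> borel_measurable M"
  by (rule measurable_processes; simp)+

text \<open>For the noise-free equation, \<open>alpha\<close> and \<open>beta\<close> are the
  coefficients of the initial position and velocity in u1 times the position plus u2 times the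
  velocity at time t.\<close>

definition alpha :: "real \<Rightarrow> real \<Rightarrow> real \<Rightarrow> real" where
  "alpha u1 u2 t = u1 * (h t + 2 * z * g t) - u2 * c\<^sup>2 * g t"

definition beta :: "real \<Rightarrow> real \<Rightarrow> real \<Rightarrow> real" where
  "beta u1 u2 t = u1 * g t + u2 * h t"

text \<open>A primitive of \<open>(beta u1 u2)\<^sup>2\<close> that vanishes at infinity.\<close>

definition beta_primitive :: "real \<Rightarrow> real \<Rightarrow> real \<Rightarrow> real" where
  "beta_primitive u1 u2 t = u1\<^sup>2 * ((- (c\<^sup>2 * (g t)\<^sup>2 + (h t)\<^sup>2) / (4 * z) - g t * h t - z * (g t)\<^sup>2) / c\<^sup>2)
     + u1 * u2 * (g t)\<^sup>2 - u2\<^sup>2 * ((c\<^sup>2 * (g t)\<^sup>2 + (h t)\<^sup>2) / (4 * z))"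

lemma deriv_gh:
  "(g has_real_derivative h t) (at t)" "(h has_real_derivative - c\<^sup>2 * g t - 2 * z * h t) (at t)"
  using orb by (simp_all add: oscillator_orbit_def)

lemma deriv_beta_primitive: "(beta_primitive u1 u2 has_real_derivative (beta u1 u2 t)\<^sup>2) (at t)"
  unfolding beta_primitive_def beta_def using zc
  by (auto intro!: derivative_eq_intros deriv_gh simp: field_simps power2_eq_square)

lemma deriv_alpha: "(alpha u1 u2 has_real_derivative - c\<^sup>2 * beta u1 u2 t) (at t)"
  unfolding alpha_def beta_def
  by (auto intro!: derivative_eq_intros deriv_gh simp: algebra_simps)

lemma deriv_beta: "(beta u1 u2 has_real_derivative alpha u1 u2 t - 2 * z * beta u1 u2 t) (at t)"
  unfolding alpha_def beta_def
  by (auto intro!: derivative_eq_intros deriv_gh simp: algebra_simps)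

text \<open>Multiplied by - \<nu>^2, this is the variance of the combination with coefficients
  \<open>u1\<close> and \<open>u2\<close> in the stationary regime.\<close>

lemma beta_primitive_0: "beta_primitive u1 u2 0 = - (u1\<^sup>2 / (4 * z * c\<^sup>2) + u2\<^sup>2 / (4 * z))"
  using zc by (simp add: beta_primitive_def init field_simps)

lemma tendsto_at_top_0:
  "(alpha u1 u2 \<longlongrightarrow> 0) at_top" "(beta u1 u2 \<longlongrightarrow> 0) at_top" "(beta_primitive u1 u2 \<longlongrightarrow> 0) at_top"
  unfolding alpha_def beta_def beta_primitive_def using zc
  by (auto intro!: tendsto_eq_intros oscillator_orbit_tendsto[OF zc orb])

text \<open>Reversing time in \<open>alpha\<close> and \<open>beta\<close> solves the adjoint
  equation with terminal value \<open>(u1, u2)\<close> at \<open>T\<close>. The result is the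
  variation of constants formula along each path, with sums in place of a stochastic
  integral.\<close>

lemma increment_sum_tendsto:
  assumes T: "T \<ge> 0"
  shows "AE x in M. (\<lambda>n. \<Sum>i<Suc n. \<nu> * beta u1 u2 (T - real i * T / real (Suc n)) *
      (W (real (Suc i) * T / real (Suc n)) x - W (real i * T / real (Suc n)) x))
    \<longlonglongrightarrow> u1 * \<eta> T x + u2 * \<eta>' T x - (alpha u1 u2 T * \<eta> 0 x + beta u1 u2 T * \<eta>' 0 x)"
proof -
  have "AE x in M. continuous_on {0..} (\<lambda>t. \<eta>' t x) \<and>
        (\<forall>t\<ge>0. ((\<lambda>s. \<eta> s x) has_real_derivative \<eta>' t x) (at t within {0..})) \<and>
        (\<forall>t\<ge>0. \<eta>' t x - \<eta>' 0 x + integral {0..t} (\<lambda>s. 2 * z * \<eta>' s x + c\<^sup>2 * \<eta> s x)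
                 = \<nu> * (W t x - W 0 x))"
    using sol by (simp add: oscillator_solution_def)
  then show ?thesis
  proof eventually_elim
    case (elim x)
    have "((\<lambda>s. alpha u1 u2 (T - s)) has_real_derivative c\<^sup>2 * beta u1 u2 (T - t)) (at t)" for t
      by (rule DERIV_cong[OF DERIV_chain2[OF deriv_alpha]]) (auto intro!: derivative_eq_intros)
    moreover have "((\<lambda>s. beta u1 u2 (T - s)) has_real_derivative
        2 * z * beta u1 u2 (T - t) - alpha u1 u2 (T - t)) (at t)" for t
      by (rule DERIV_cong[OF DERIV_chain2[OF deriv_beta]]) (auto intro!: derivative_eq_intros)
    ultimately have "(\<lambda>n. \<Sum>i<Suc n. \<nu> * beta u1 u2 (T - real i * T / real (Suc n)) *
        (W (real (Suc i) * T / real (Suc n)) x - W (real i * T / real (Suc n)) x))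
      \<longlonglongrightarrow> (alpha u1 u2 (T - T) * \<eta> T x + beta u1 u2 (T - T) * \<eta>' T x)
          - (alpha u1 u2 (T - 0) * \<eta> 0 x + beta u1 u2 (T - 0) * \<eta>' 0 x)"
      using elim
      by (intro grid_stochastic_sum_tendsto[where P = "\<lambda>s. alpha u1 u2 (T - s)" and z = z and c = c
            and x = "\<lambda>t. \<eta> t x" and y = "\<lambda>t. \<eta>' t x" and w = "\<lambda>t. W t x"] T) auto
    then show ?case
      by (simp add: alpha_def[of _ _ 0] beta_def[of _ _ 0] init)
  qed
qed

lemma indep_initial_increments:
  assumes "0 \<le> \<tau> 0" "mono \<tau>"
  shows "indep_var borel (\<lambda>x. a * \<eta> 0 x + b * \<eta>' 0 x)
    borel (\<lambda>x. \<Sum>i<n. k i * (W (\<tau> (Suc i)) x - W (\<tau> i) x))"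
proof -
  have pos: "0 \<le> \<tau> i" for i
    using assms monoD[OF assms(2), of 0 i] by simp
  define F where "F w = (\<Sum>i<n. k i * (w (\<tau> (Suc i)) - w (\<tau> i)))" for w :: "real \<Rightarrow> real"
  define f where "f p = a * fst p + b * snd p" for p :: "real \<times> real"
  have "indep_var borel (\<lambda>x. f (\<eta> 0 x, \<eta>' 0 x)) borel (\<lambda>x. F (\<lambda>t\<in>{0..}. W t x))"
  proof (rule indep_var_noise_functional[where Z = "\<lambda>x. (\<eta> 0 x, \<eta>' 0 x)", OF prob_space_axioms])
    show "independent_of_noise M W (\<lambda>x. (\<eta> 0 x, \<eta>' 0 x))"
      using sol by (simp add: oscillator_solution_def)
    show "f \<in> borel_measurable borel"
      unfolding f_def by (intro borel_measurable_continuous_onI continuous_intros)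
    show "F \<in> borel_measurable (\<Pi>\<^sub>M t\<in>{0..}. borel)"
      unfolding F_def using pos
      by (intro borel_measurable_sum borel_measurable_times borel_measurable_diff
          measurable_component_singleton) auto
  qed (simp_all add: measurable_processes borel_measurable_Pair)
  then show ?thesis
    using pos by (simp add: f_def F_def)
qed

text \<open>The coefficients \<open>c1\<close> and \<open>c2\<close> retain the initial state, so
  the identity describes the joint law of the states at times 0 and \<open>T\<close>. Evaluating at
  1 is enough because all coefficients are free.\<close>

lemma char_evolution:
  assumes T: "T > 0"
  shows "char (distr M borel (\<lambda>x. (u1 * \<eta> T x + u2 * \<eta>' T x) + (c1 * \<eta> 0 x + c2 * \<eta>' 0 x))) 1 =
    char (distr M borel (\<lambda>x. (alpha u1 u2 T + c1) * \<eta> 0 x + (beta u1 u2 T + c2) * \<eta>' 0 x)) 1 *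
    exp (- (\<nu>\<^sup>2 * (beta_primitive u1 u2 T - beta_primitive u1 u2 0)) / 2)"
proof -
  let ?X = "\<lambda>x. (alpha u1 u2 T + c1) * \<eta> 0 x + (beta u1 u2 T + c2) * \<eta>' 0 x"
  let ?L = "\<lambda>x. (u1 * \<eta> T x + u2 * \<eta>' T x) + (c1 * \<eta> 0 x + c2 * \<eta>' 0 x)"
  have [measurable]: "\<eta> T \<in> borel_measurable M" "\<eta>' T \<in> borel_measurable M"
    using T by (simp_all add: measurable_processes)
  define \<tau> where "\<tau> n i = real i * T / real (Suc n)" for n i
  define k where "k n i = \<nu> * beta u1 u2 (T - \<tau> n i)" for n i
  define S where "S n x = (\<Sum>i<Suc n. k n i * (W (\<tau> n (Suc i)) x - W (\<tau> n i) x))" for n x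
  have \<tau>: "strict_mono (\<tau> n)" "0 \<le> \<tau> n 0" for n
    using T by (auto simp: \<tau>_def strict_mono_def divide_strict_right_mono)
  have indep: "indep_var borel ?X borel (S n)" for n
    unfolding S_def by (intro indep_initial_increments \<tau> strict_mono_mono)
  have [measurable]: "S n \<in> borel_measurable M" for n
    using indep_var_rv2[OF indep] .
  have "AE x in M. (\<lambda>n. ?X x + S n x) \<longlonglongrightarrow> ?L x"
    using increment_sum_tendsto[OF less_imp_le[OF T], of u1 u2]
  proof eventually_elim
    case (elim x)
    then have "(\<lambda>n. S n x) \<longlonglongrightarrow> u1 * \<eta> T x + u2 * \<eta>' T x - (alpha u1 u2 T * \<eta> 0 x + beta u1 u2 T * \<eta>' 0 x)"
      by (simp add: S_def k_def \<tau>_def)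
    then have "(\<lambda>n. ?X x + S n x) \<longlonglongrightarrow> ?X x + (u1 * \<eta> T x + u2 * \<eta>' T x - (alpha u1 u2 T * \<eta> 0 x + beta u1 u2 T * \<eta>' 0 x))"
      by (intro tendsto_add tendsto_const)
    then show ?case by (simp add: algebra_simps)
  qed
  then have "(\<lambda>n. char (distr M borel (\<lambda>x. ?X x + S n x)) 1) \<longlonglongrightarrow> char (distr M borel ?L) 1"
    by (intro char_distr_tendsto prob_space_axioms) measurable
  moreover have "char (distr M borel (\<lambda>x. ?X x + S n x)) 1 = char (distr M borel ?X) 1 *
      exp (- (\<Sum>i<Suc n. (k n i)\<^sup>2 * (\<tau> n (Suc i) - \<tau> n i)) / 2)" for n
    unfolding char_distr_add[OF indep]
    using char_brownian_increment_sum[OF W \<tau>(1)[of n] \<tau>(2)[of n], where n = "Suc n" and k = "k n" and t = 1] by (simp add: S_def[abs_def])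
  moreover have "(\<lambda>n. char (distr M borel ?X) 1 *
      exp (- (\<Sum>i<Suc n. (k n i)\<^sup>2 * (\<tau> n (Suc i) - \<tau> n i)) / 2)) \<longlonglongrightarrow>
      char (distr M borel ?X) 1 * exp (- (\<nu>\<^sup>2 * (beta_primitive u1 u2 T - beta_primitive u1 u2 0)) / 2)"
  proof -
    \<comment> \<open>The variances form a Riemann sum for the square of \<nu> beta in reversed
      time; the reversal causes the minus sign of the primitive.\<close>
    have "((\<lambda>s. - (\<nu>\<^sup>2 * beta_primitive u1 u2 (T - s))) has_real_derivative (\<nu> * beta u1 u2 (T - t))\<^sup>2) (at t)" for t
      by (auto intro!: derivative_eq_intros DERIV_chain2[OF deriv_beta_primitive] simp: power_mult_distrib)
    moreover have "continuous_on UNIV (\<lambda>t. (\<nu> * beta u1 u2 (T - t))\<^sup>2)"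
      unfolding beta_def
      by (intro continuous_intros continuous_on_compose2[OF oscillator_orbit_continuous(1)[OF orb]]
          continuous_on_compose2[OF oscillator_orbit_continuous(2)[OF orb]]) auto
    ultimately have "(\<lambda>n. \<Sum>i<Suc n. (k n i)\<^sup>2 * (\<tau> n (Suc i) - \<tau> n i)) \<longlonglongrightarrow>
        - (\<nu>\<^sup>2 * beta_primitive u1 u2 (T - T)) - - (\<nu>\<^sup>2 * beta_primitive u1 u2 (T - 0))"
      unfolding k_def \<tau>_def using T by (intro grid_riemann_sum_tendsto) auto
    then have "(\<lambda>n. \<Sum>i<Suc n. (k n i)\<^sup>2 * (\<tau> n (Suc i) - \<tau> n i)) \<longlonglongrightarrow> \<nu>\<^sup>2 * (beta_primitive u1 u2 T - beta_primitive u1 u2 0)"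
      by (simp add: algebra_simps)
    then show ?thesis
      by (intro tendsto_mult tendsto_of_real tendsto_exp tendsto_divide tendsto_minus tendsto_const) auto
  qed
  ultimately show ?thesis
    using LIMSEQ_unique by (simp only: )
qed

text \<open>Stationarity is given for \<eta> alone. The velocity is an almost sure limit of
  difference quotients, each a function of \<eta> at two times, so shift invariance passes to the
  limit of the characteristic functions.\<close>

lemma char_stationary:
  assumes T: "T \<ge> 0"
  shows "char (distr M borel (\<lambda>x. a * \<eta> T x + b * \<eta>' T x)) 1 =
    char (distr M borel (\<lambda>x. a * \<eta> 0 x + b * \<eta>' 0 x)) 1"
proof -
  \<comment> \<open>Positive steps keep \<open>t + \<delta> n\<close> in the half-line, where the
    one-sided derivative at 0 is taken.\<close>
  define \<delta> where "\<delta> n = 1 / real (Suc n)" for n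
  have \<delta>: "\<delta> n > 0" "\<delta> n \<noteq> 0" for n by (simp_all add: \<delta>_def)
  have \<delta>0: "\<delta> \<longlonglongrightarrow> 0"
    unfolding \<delta>_def using LIMSEQ_Suc[OF lim_const_over_n[of 1]] by simp
  define Q where "Q t n x = a * \<eta> t x + b * ((\<eta> (t + \<delta> n) x - \<eta> t x) / \<delta> n)" for t n x
  have lim: "(\<lambda>n. char (distr M borel (Q t n)) 1) \<longlonglongrightarrow> char (distr M borel (\<lambda>x. a * \<eta> t x + b * \<eta>' t x)) 1"
    if t: "t \<ge> 0" for t
  proof (rule char_distr_tendsto[OF prob_space_axioms])
    show "Q t n \<in> borel_measurable M" for n
      unfolding Q_def using measurable_processes[of t] measurable_processes[of "t + \<delta> n"] t \<delta>[of n] by simp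
    show "(\<lambda>x. a * \<eta> t x + b * \<eta>' t x) \<in> borel_measurable M"
      using measurable_processes[of t] t by simp
    have "AE x in M. ((\<lambda>s. \<eta> s x) has_real_derivative \<eta>' t x) (at t within {0..})"
      using sol t unfolding oscillator_solution_def by auto
    then show "AE x in M. (\<lambda>n. Q t n x) \<longlonglongrightarrow> a * \<eta> t x + b * \<eta>' t x"
    proof eventually_elim
      case (elim x)
      have "filterlim (\<lambda>n. t + \<delta> n) (at t within {0..}) sequentially"
        unfolding filterlim_at using \<delta> t
        by (auto intro!: tendsto_eq_intros \<delta>0 always_eventually simp: add_nonneg_nonneg less_imp_le)
      from filterlim_compose[OF elim[unfolded has_field_derivative_iff] this]
      show ?case unfolding Q_def by (intro tendsto_intros) simp
    qed
  qed
  have "distr M borel (Q T n) = distr M borel (Q 0 n)" for n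
  proof -
    let ?P = "\<Pi>\<^sub>M t\<in>{0, \<delta> n}. (borel :: real measure)"
    let ?f = "\<lambda>\<omega>. a * \<omega> 0 + b * ((\<omega> (\<delta> n) - \<omega> 0) / \<delta> n)"
    have f: "?f \<in> borel_measurable ?P" by measurable
    have eq: "distr M borel (Q t n) = distr (distr M ?P (\<lambda>x. \<lambda>s\<in>{0, \<delta> n}. \<eta> (s + t) x)) borel ?f" if "t \<ge> 0" for t
    proof -
      have "(\<lambda>x. \<lambda>s\<in>{0, \<delta> n}. \<eta> (s + t) x) \<in> measurable M ?P"
        using that \<delta>[of n] by (intro measurable_restrict) (auto intro!: measurable_processes)
      from distr_distr[OF f this] show ?thesis
        by (simp add: Q_def[abs_def] comp_def add.commute)
    qed
    have "distr M ?P (\<lambda>x. \<lambda>s\<in>{0, \<delta> n}. \<eta> (s + T) x) = distr M ?P (\<lambda>x. \<lambda>s\<in>{0, \<delta> n}. \<eta> s x)"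
      using stat[unfolded strictly_stationary_def, rule_format, of "{0, \<delta> n}" T] T \<delta>[of n] by simp
    then show ?thesis using eq[OF T] eq[of 0] by simp
  qed
  then show ?thesis using LIMSEQ_unique[OF lim[OF T]] lim[of 0] by simp
qed

text \<open>By stationarity the left side of \<open>char_evolution\<close> with
  \<open>c1 = c2 = 0\<close> is independent of the time. As time grows the memory of the initial
  state fades, its factor tends to 1, and the Gaussian factor alone survives.\<close>

lemma char_initial_state:
  "char (distr M borel (\<lambda>x. a * \<eta> 0 x + b * \<eta>' 0 x)) 1 =
    exp (- (\<nu>\<^sup>2 * (a\<^sup>2 / (4 * z * c\<^sup>2) + b\<^sup>2 / (4 * z))) / 2)"
proof (rule LIMSEQ_unique)
  \<comment> \<open>Times \<open>Suc n\<close> are positive, as \<open>char_evolution\<close>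
    demands.\<close>
  have top: "filterlim (\<lambda>n. real (Suc n)) at_top sequentially"
    using filterlim_compose[OF filterlim_real_sequentially filterlim_Suc] .
  note lims = filterlim_compose[OF tendsto_at_top_0(1) top] filterlim_compose[OF tendsto_at_top_0(2) top]
    filterlim_compose[OF tendsto_at_top_0(3) top]
  have eq: "char (distr M borel (\<lambda>x. a * \<eta> 0 x + b * \<eta>' 0 x)) 1 =
      char (distr M borel (\<lambda>x. alpha a b (Suc n) * \<eta> 0 x + beta a b (Suc n) * \<eta>' 0 x)) 1 *
      exp (- (\<nu>\<^sup>2 * (beta_primitive a b (Suc n) - beta_primitive a b 0)) / 2)" for n
    using char_evolution[of "real (Suc n)" a b 0 0] char_stationary[of "real (Suc n)" a b] by simp
  have "(\<lambda>n. char (distr M borel (\<lambda>x. alpha a b (Suc n) * \<eta> 0 x + beta a b (Suc n) * \<eta>' 0 x)) 1)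
      \<longlonglongrightarrow> char (distr M borel (\<lambda>x. 0)) 1"
  proof (rule char_distr_tendsto[OF prob_space_axioms])
    have "(\<lambda>n. alpha a b (Suc n) * \<eta> 0 x + beta a b (Suc n) * \<eta>' 0 x) \<longlonglongrightarrow> 0 * \<eta> 0 x + 0 * \<eta>' 0 x" for x
      by (intro tendsto_intros lims)
    then show "AE x in M. (\<lambda>n. alpha a b (Suc n) * \<eta> 0 x + beta a b (Suc n) * \<eta>' 0 x) \<longlonglongrightarrow> 0"
      by simp
  qed simp_all
  moreover have "char (distr M borel (\<lambda>x. 0)) 1 = 1"
    by (simp add: char_distr prob_space del: distr_const)
  ultimately have phi: "(\<lambda>n. char (distr M borel (\<lambda>x. alpha a b (Suc n) * \<eta> 0 x + beta a b (Suc n) * \<eta>' 0 x)) 1)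
      \<longlonglongrightarrow> 1" by simp
  have "(\<lambda>n. complex_of_real (exp (- (\<nu>\<^sup>2 * (beta_primitive a b (Suc n) - beta_primitive a b 0)) / 2))) \<longlonglongrightarrow>
      of_real (exp (- (\<nu>\<^sup>2 * (0 - beta_primitive a b 0)) / 2))"
    by (intro tendsto_intros lims) simp
  from tendsto_mult[OF phi this]
  show "(\<lambda>_::nat. char (distr M borel (\<lambda>x. a * \<eta> 0 x + b * \<eta>' 0 x)) 1)
      \<longlonglongrightarrow> exp (- (\<nu>\<^sup>2 * (a\<^sup>2 / (4 * z * c\<^sup>2) + b\<^sup>2 / (4 * z))) / 2)"
    unfolding eq[symmetric] by (simp add: beta_primitive_0 add.commute)
qed simp

lemma velocity_combination_second_moment:
  assumes T: "T > 0"
  shows "integrable M (\<lambda>x. (\<eta>' T x + e * \<eta>' 0 x)\<^sup>2)"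
    "(\<integral>x. (\<eta>' T x + e * \<eta>' 0 x)\<^sup>2 \<partial>M) = \<nu>\<^sup>2 / (4 * z) * (1 + 2 * e * h T + e\<^sup>2)"
proof -
  have [measurable]: "\<eta>' T \<in> borel_measurable M" using T by (simp add: measurable_processes)
  define K where "K = \<nu>\<^sup>2 / (4 * z) * (1 + 2 * e * h T + e\<^sup>2)"
  have "char (distr M borel (\<lambda>x. \<eta>' T x + e * \<eta>' 0 x)) t = exp (- K * t\<^sup>2 / 2)" for t
  proof -
    have "char (distr M borel (\<lambda>x. \<eta>' T x + e * \<eta>' 0 x)) t =
        char (distr M borel (\<lambda>x. (0 * \<eta> T x + t * \<eta>' T x) + (0 * \<eta> 0 x + (t * e) * \<eta>' 0 x))) 1"
      using char_distr_mult[of "\<lambda>x. \<eta>' T x + e * \<eta>' 0 x" M t 1] by (simp add: algebra_simps)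
    also have "\<dots> = exp (- (\<nu>\<^sup>2 * ((alpha 0 t T + 0)\<^sup>2 / (4 * z * c\<^sup>2) + (beta 0 t T + t * e)\<^sup>2 / (4 * z))) / 2) *
        exp (- (\<nu>\<^sup>2 * (beta_primitive 0 t T - beta_primitive 0 t 0)) / 2)"
      unfolding char_evolution[OF T] char_initial_state by simp
    also have "\<dots> = exp (- (\<nu>\<^sup>2 * ((alpha 0 t T + 0)\<^sup>2 / (4 * z * c\<^sup>2) + (beta 0 t T + t * e)\<^sup>2 / (4 * z))) / 2
        + - (\<nu>\<^sup>2 * (beta_primitive 0 t T - beta_primitive 0 t 0)) / 2)"
      unfolding exp_add by simp
    \<comment> \<open>The squares of \<open>g T\<close> and \<open>h T\<close> from the initial
      state cancel those in \<open>beta_primitive\<close>. Only the cross term with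
      \<open>h T\<close> still depends on \<open>T\<close>.\<close>
    also have "- (\<nu>\<^sup>2 * ((alpha 0 t T + 0)\<^sup>2 / (4 * z * c\<^sup>2) + (beta 0 t T + t * e)\<^sup>2 / (4 * z))) / 2
        + - (\<nu>\<^sup>2 * (beta_primitive 0 t T - beta_primitive 0 t 0)) / 2 = - K * t\<^sup>2 / 2"
      unfolding beta_primitive_0 using zc
      by (simp add: alpha_def beta_def beta_primitive_def K_def field_simps power2_eq_square)
    finally show ?thesis .
  qed
  from second_moment_of_gaussian_char[OF prob_space_axioms _ this]
  show "integrable M (\<lambda>x. (\<eta>' T x + e * \<eta>' 0 x)\<^sup>2)"
    "(\<integral>x. (\<eta>' T x + e * \<eta>' 0 x)\<^sup>2 \<partial>M) = \<nu>\<^sup>2 / (4 * z) * (1 + 2 * e * h T + e\<^sup>2)"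
    by (simp_all add: K_def)
qed

lemma velocity_autocovariance:
  assumes T: "T \<ge> 0"
  shows "(\<integral>x. \<eta>' T x * \<eta>' 0 x \<partial>M) = \<nu>\<^sup>2 / (4 * z) * h T"
proof (cases "T = 0")
  \<comment> \<open>At time 0 \<open>char_evolution\<close> does not apply; the Gaussian law of the
    initial velocity gives the variance directly, and \<open>h 0 = 1\<close>.\<close>
  case True
  have "char (distr M borel (\<eta>' 0)) t = exp (- (\<nu>\<^sup>2 / (4 * z)) * t\<^sup>2 / 2)" for t
    using char_distr_mult[of "\<eta>' 0" M t 1] char_initial_state[of 0 t] by simp
  from second_moment_of_gaussian_char(2)[OF prob_space_axioms _ this] True init
  show ?thesis by (simp add: power2_eq_square)
next
  case False
  then have "T > 0" using T by simp
  note m = velocity_combination_second_moment[OF this]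
  \<comment> \<open>Polarization: both squares are integrable, so the integral may be split.\<close>
  have "(\<integral>x. \<eta>' T x * \<eta>' 0 x \<partial>M) =
      (\<integral>x. ((\<eta>' T x + 1 * \<eta>' 0 x)\<^sup>2 - (\<eta>' T x + (-1) * \<eta>' 0 x)\<^sup>2) / 4 \<partial>M)"
    by (rule Bochner_Integration.integral_cong) (auto simp: power2_eq_square algebra_simps)
  also have "\<dots> = ((\<integral>x. (\<eta>' T x + 1 * \<eta>' 0 x)\<^sup>2 \<partial>M) - (\<integral>x. (\<eta>' T x + (-1) * \<eta>' 0 x)\<^sup>2 \<partial>M)) / 4"
    unfolding integral_divide_zero Bochner_Integration.integral_diff[OF m(1) m(1)] ..
  also have "\<dots> = \<nu>\<^sup>2 / (4 * z) * h T"
    unfolding m(2) using zc by (simp add: field_simps)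
  finally show ?thesis .
qed

text \<open>The autocovariance is a multiple of \<open>h\<close>, so the density is the cosine
  transform of an orbit velocity with initial data 0 and 1.\<close>

lemma power_spectral_density_velocity:
  assumes w: "w \<noteq> 0"
  shows "pi * power_spectral_density M \<eta>' w
    = w\<^sup>2 * \<nu>\<^sup>2 / (2 * ((c\<^sup>2 - w\<^sup>2)\<^sup>2 + 4 * z\<^sup>2 * w\<^sup>2))"
proof -
  define D where "D = (c\<^sup>2 - w\<^sup>2)\<^sup>2 + 4 * z\<^sup>2 * w\<^sup>2"
  have "pi * power_spectral_density M \<eta>' w =
      (LINT t:{0..}|lborel. (\<integral>x. \<eta>' t x * \<eta>' 0 x \<partial>M) * cos (w * t))"
    by (simp add: power_spectral_density_def)
  also have "\<dots> = (LINT t:{0..}|lborel. \<nu>\<^sup>2 / (4 * z) * (cos (w * t) * h t))"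
    by (rule set_lebesgue_integral_cong) (auto simp: velocity_autocovariance)
  also have "\<dots> = \<nu>\<^sup>2 / (4 * z) * (2 * z * w\<^sup>2 / D)"
    using oscillator_orbit_cosine_integrals(1)[OF zc orb w, folded D_def] by (simp add: init)
  also have "\<dots> = w\<^sup>2 * \<nu>\<^sup>2 / (2 * D)"
    \<comment> \<open>Division by zero yields zero, so both sides agree in the formal case
      \<open>D = 0\<close> too.\<close>
    using zc by (cases "D = 0") (simp_all add: field_simps)
  finally show ?thesis by (simp only: D_def)
qed

end

text \<open>The first row of the system is the fundamental theorem of calculus for \<eta>, and the
  second is the integrated oscillator equation with its drift moved to the right.\<close>

lemma oscillator_solution_linear_sde:
  assumes M: "prob_space M" and sol: "oscillator_solution M W z c \<nu> \<eta> \<eta>'"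
  shows "linear_sde_solution M W (oscillator_matrix z c) (vector [0, \<nu>])
      (\<lambda>t x. vector [\<eta> t x, \<eta>' t x])"
    and "AE x in M. \<forall>t\<ge>0. \<eta>' t x - \<eta>' 0 x =
      integral {0..t} (\<lambda>s. vector [- (c\<^sup>2), - 2 * z] \<bullet> (vector [\<eta> s x, \<eta>' s x] :: real^2)) + \<nu> * (W t x - W 0 x)"
proof -
  let ?v = "\<lambda>t x. vector [\<eta> t x, \<eta>' t x] :: real^2"
  \<comment> \<open>The continuous map from pairs to vectors transfers measurability and
    independence to the state.\<close>
  define f :: "real \<times> real \<Rightarrow> real^2" where "f p = fst p *\<^sub>R axis 1 1 + snd p *\<^sub>R axis 2 1" for p
  have f: "f \<in> borel_measurable borel"
    unfolding f_def by (intro borel_measurable_continuous_onI continuous_intros)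
  have v: "?v t x = f (\<eta> t x, \<eta>' t x)" for t x
    by (simp add: f_def vec_eq_iff forall_2 axis_def)
  have meas: "?v t \<in> borel_measurable M" if "t \<ge> 0" for t
    unfolding v using sol that
    by (intro measurable_compose[OF _ f]) (simp add: oscillator_solution_def borel_measurable_Pair)
  have ind: "independent_of_noise M W (?v 0)"
    unfolding v using sol by (intro independent_of_noise_compose[OF M _ f]) (simp add: oscillator_solution_def)
  have ae: "AE x in M. continuous_on {0..} (\<lambda>t. \<eta>' t x) \<and>
        (\<forall>t\<ge>0. ((\<lambda>s. \<eta> s x) has_real_derivative \<eta>' t x) (at t within {0..})) \<and>
        (\<forall>t\<ge>0. \<eta>' t x - \<eta>' 0 x + integral {0..t} (\<lambda>s. 2 * z * \<eta>' s x + c\<^sup>2 * \<eta> s x)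
                 = \<nu> * (W t x - W 0 x))"
    using sol by (simp add: oscillator_solution_def)
  have drift: "integral {0..t} (\<lambda>s. - c\<^sup>2 * \<eta> s x - 2 * z * \<eta>' s x) =
      - integral {0..t} (\<lambda>s. 2 * z * \<eta>' s x + c\<^sup>2 * \<eta> s x)" for t x
    unfolding integral_neg[symmetric] by (rule arg_cong[where f = "integral _"]) auto
  show "AE x in M. \<forall>t\<ge>0. \<eta>' t x - \<eta>' 0 x =
      integral {0..t} (\<lambda>s. vector [- (c\<^sup>2), - 2 * z] \<bullet> ?v s x) + \<nu> * (W t x - W 0 x)"
    using ae
  proof eventually_elim
    case (elim x)
    have "vector [- (c\<^sup>2), - 2 * z] \<bullet> ?v s x = - c\<^sup>2 * \<eta> s x - 2 * z * \<eta>' s x" for s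
      by (simp add: inner_vec_def sum_2)
    then show ?case using elim by (simp add: drift[simplified]) (simp add: algebra_simps)
  qed
  have "AE x in M. continuous_on {0..} (\<lambda>t. ?v t x) \<and>
      (\<forall>t\<ge>0. ?v t x - ?v 0 x = integral {0..t} (\<lambda>s. oscillator_matrix z c *v ?v s x)
        + (W t x - W 0 x) *\<^sub>R vector [0, \<nu>])"
    using ae
  proof eventually_elim
    case (elim x)
    have "continuous_on {0..} (\<lambda>t. \<eta> t x)"
      using elim by (auto simp: continuous_on_eq_continuous_within intro!: DERIV_continuous)
    then have cont: "continuous_on {0..} (\<lambda>t. ?v t x)"
      unfolding v f_def using elim by (auto intro!: continuous_intros)
    have "?v t x - ?v 0 x = integral {0..t} (\<lambda>s. oscillator_matrix z c *v ?v s x)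
        + (W t x - W 0 x) *\<^sub>R vector [0, \<nu>]" if t: "t \<ge> 0" for t
    proof -
      have "continuous_on {0..t} (\<lambda>s. oscillator_matrix z c *v ?v s x)"
        by (intro bounded_linear.continuous_on[OF matrix_vector_mul_bounded_linear]
            continuous_on_subset[OF cont]) auto
      then have int: "(\<lambda>s. oscillator_matrix z c *v ?v s x) integrable_on {0..t}"
        by (rule integrable_continuous_real)
      have comp: "integral {0..t} (\<lambda>s. oscillator_matrix z c *v ?v s x) $ i =
          integral {0..t} (\<lambda>s. (oscillator_matrix z c *v ?v s x) $ i)" for i
        using integral_linear[OF int bounded_linear_vec_nth[of i]] by (simp add: comp_def)
      have "(\<lambda>s. \<eta>' s x) integrable_on {0..t} \<and> integral {0..t} (\<lambda>s. \<eta>' s x) = \<eta> t x - \<eta> 0 x"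
      proof -
        have "((\<lambda>s. \<eta>' s x) has_integral \<eta> t x - \<eta> 0 x) {0..t}"
        proof (rule fundamental_theorem_of_calculus[OF t])
          fix s assume "s \<in> {0..t}"
          then have "((\<lambda>s. \<eta> s x) has_real_derivative \<eta>' s x) (at s within {0..})"
            using elim by simp
          then show "((\<lambda>s. \<eta> s x) has_vector_derivative \<eta>' s x) (at s within {0..t})"
            unfolding has_real_derivative_iff_has_vector_derivative[symmetric]
            by (rule has_field_derivative_subset) auto
        qed
        then show ?thesis by (auto simp: has_integral_iff)
      qed
      moreover have "\<eta>' t x - \<eta>' 0 x + integral {0..t} (\<lambda>s. 2 * z * \<eta>' s x + c\<^sup>2 * \<eta> s x)
                 = \<nu> * (W t x - W 0 x)" using elim t by blast
      ultimately show ?thesis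
        by (simp add: vec_eq_iff forall_2 comp oscillator_matrix_mult_vec drift[simplified] del: drift)
          (simp add: algebra_simps)
    qed
    with cont show ?case by blast
  qed
  with meas ind show "linear_sde_solution M W (oscillator_matrix z c) (vector [0, \<nu>]) ?v"
    by (simp add: linear_sde_solution_def)
qed

theorem corollary5p1:
  fixes M :: "'w measure"
    and W \<eta> \<eta>' :: "real \<Rightarrow> 'w \<Rightarrow> real"
    and v :: "real \<Rightarrow> 'w \<Rightarrow> real^2"
    and \<zeta>1 chi \<nu> \<gamma> :: real
    and A :: "real^2^2"
    and B a :: "real^2"
  assumes "\<zeta>1 > 0" and "chi > 0" and "\<nu> > 0"
    and "standard_brownian_motion M W"
    and "oscillator_solution M W \<zeta>1 chi \<nu> \<eta> \<eta>'"
    and "strictly_stationary M \<eta>"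
    and "A = vector [vector [0, 1], vector [- (chi\<^sup>2), - 2 * \<zeta>1]]"
    and "B = vector [0, \<nu>]"
    and "a = vector [- (chi\<^sup>2), - 2 * \<zeta>1]"
    and "\<gamma> = \<nu>"
    and "v = (\<lambda>t x. vector [\<eta> t x, \<eta>' t x])"
  shows "linear_sde_solution M W A B v
    \<and> (AE x in M. \<forall>t\<ge>0. \<eta>' t x - \<eta>' 0 x
           = integral {0..t} (\<lambda>s. a \<bullet> v s x) + \<gamma> * (W t x - W 0 x))
    \<and> (\<forall>\<omega>. \<omega> \<noteq> 0 \<longrightarrow>
         lambda2 A B a \<gamma> \<omega> = pi * power_spectral_density M \<eta>' \<omega>
         \<and> pi * power_spectral_density M \<eta>' \<omega>
             = \<omega>\<^sup>2 * \<nu>\<^sup>2 / (2 * ((chi\<^sup>2 - \<omega>\<^sup>2)\<^sup>2 + 4 * \<zeta>1\<^sup>2 * \<omega>\<^sup>2)))"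
proof -
  have M: "prob_space M"
    using assms(4) by (simp add: standard_brownian_motion_def)
  have A: "A = oscillator_matrix \<zeta>1 chi"
    by (simp add: assms(7) oscillator_matrix_def)
  \<comment> \<open>The second column of the exponential is the orbit with initial position 0 and
    velocity 1.\<close>
  interpret stationary_oscillator M W \<eta> \<eta>' \<zeta>1 chi \<nu>
    "\<lambda>t. (matrix_exp (t *\<^sub>R A) *v axis 2 1) $ 1" "\<lambda>t. (matrix_exp (t *\<^sub>R A) *v axis 2 1) $ 2"
    using M assms(1-6) oscillator_orbit_matrix_exp[of \<zeta>1 chi "axis 2 1"]
    unfolding stationary_oscillator_def stationary_oscillator_axioms_def A
    by (simp add: matrix_exp_0_vec axis_def)
  show ?thesis
    unfolding A assms(8-11)
  proof (intro conjI allI impI)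
    fix \<omega> :: real assume \<omega>: "\<omega> \<noteq> 0"
    show "lambda2 (oscillator_matrix \<zeta>1 chi) (vector [0, \<nu>]) (vector [- (chi\<^sup>2), - 2 * \<zeta>1]) \<nu> \<omega> =
        pi * power_spectral_density M \<eta>' \<omega>"
      \<comment> \<open>Both sides have been evaluated to the same rational function.\<close>
      unfolding lambda2_oscillator[OF assms(1,2) \<omega>] power_spectral_density_velocity[OF \<omega>] ..
  qed (fact oscillator_solution_linear_sde[OF M assms(5)] power_spectral_density_velocity)+
qed

end
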